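(* Let $n\ge 1$, let $\Omega$ be a finite subset of $\mathbb{Z}^n$, and let $\lambda_i$ be the $i$-th eigenvalue of the Dirichlet Laplacian on $\Omega$. If $\lambda_k<1$ for some $1\leq k\leq \sharp \Omega-1$, then $$\lambda_{k+1}\leq \left(1+\frac{4}{n(1-\lambda_k)}\right)k^{\frac{2}{n(1-\lambda_k)}}\lambda_1.$$ In particular, if $\lambda_k\leq 1-\delta$ for some $\delta>0$, then $$\lambda_{k+1}\leq \left(1+\frac{4}{n\delta}\right)k^{\frac{2}{n\delta}}\lambda_1.$$
   Context: $\mathbb{Z}^n$ denotes the integer lattice graph: vertex set $\mathbb{Z}^n$, with $x\sim y$ (neighbors) iff $\sum_{i=1}^n|x_i-y_i|=1$; every vertex has degree $d_x=2n$. The discrete Laplacian is $\Delta f(x)=\frac{1}{d_x}\sum_{y\sim x}f(y)-f(x)$ for $f:\mathbb{Z}^n\to\mathbb{R}$. For a finite subset $\Omega\subset\mathbb{Z}^n$ and $f:\Omega\to\mathbb{R}$, the Dirichlet Laplacian is $\Delta_\Omega f(x)=\Delta\widetilde f(x)$ for $x\in\Omega$, where $\widetilde f$ is the extension of $f$ by $0$ to $\mathbb{Z}^n$. It is self-adjoint on functions on $\Omega$ with inner product $\langle f,g\rangle=\sum_{x\in\Omega}f(x)g(x)d_x$. The eigenvalues of the Dirichlet Laplacian on $\Omega$ are the eigenvalues of $-\Delta_\Omega$, listed in non-decreasing order with multiplicity: $0<\lambda_1\le\lambda_2\le\cdots\le\lambda_N\le 2$, where $N=\sharp\Omega$ is the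 number of vertices of $\Omega$. *)

theory Defs
  imports "HOL-Analysis.Analysis" "HOL-Library.Function_Algebras"
begin

text \<open>The lattice \<open>\<int>\<^sup>n\<close> is the type \<open>int ^ 'n\<close> with \<open>n = CARD('n)\<close>, which is automatically
  at least 1.\<close>

definition lattice_neighbors :: "int ^ 'n \<Rightarrow> (int ^ 'n) set" where
  "lattice_neighbors x = {y. (\<Sum>i\<in>UNIV. \<bar>x $ i - y $ i\<bar>) = 1}"

definition lattice_degree :: "int ^ 'n \<Rightarrow> nat" where
  "lattice_degree x = card (lattice_neighbors x)"

definition lattice_laplacian :: "(int ^ 'n \<Rightarrow> real) \<Rightarrow> int ^ 'n \<Rightarrow> real" where
  "lattice_laplacian f x =
     1 / real (lattice_degree x) * (\<Sum>y\<in>lattice_neighbors x. f y) - f x"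

text \<open>A function \<open>\<Omega> \<rightarrow> \<real>\<close> is represented by the function on the whole lattice that agrees with
  it on \<open>\<Omega>\<close> and vanishes elsewhere.\<close>

definition functions_on :: "(int ^ 'n) set \<Rightarrow> (int ^ 'n \<Rightarrow> real) set" where
  "functions_on \<Omega> = {f. \<forall>x. x \<notin> \<Omega> \<longrightarrow> f x = 0}"

definition zero_extension :: "(int ^ 'n) set \<Rightarrow> (int ^ 'n \<Rightarrow> real) \<Rightarrow> int ^ 'n \<Rightarrow> real" where
  "zero_extension \<Omega> f = (\<lambda>x. if x \<in> \<Omega> then f x else 0)"

definition dirichlet_laplacian ::
    "(int ^ 'n) set \<Rightarrow> (int ^ 'n \<Rightarrow> real) \<Rightarrow> int ^ 'n \<Rightarrow> real" where
  "dirichlet_laplacian \<Omega> f =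
     (\<lambda>x. if x \<in> \<Omega> then lattice_laplacian (zero_extension \<Omega> f) x else 0)"

text \<open>Eigenvalues and eigenspaces are those of the negative of the Dirichlet Laplacian.\<close>

definition dirichlet_eigenspace ::
    "(int ^ 'n) set \<Rightarrow> real \<Rightarrow> (int ^ 'n \<Rightarrow> real) set" where
  "dirichlet_eigenspace \<Omega> \<mu> =
     {f \<in> functions_on \<Omega>. \<forall>x\<in>\<Omega>. - dirichlet_laplacian \<Omega> f x = \<mu> * f x}"

definition is_dirichlet_eigenvalue :: "(int ^ 'n) set \<Rightarrow> real \<Rightarrow> bool" where
  "is_dirichlet_eigenvalue \<Omega> \<mu> \<longleftrightarrow> (\<exists>f \<in> dirichlet_eigenspace \<Omega> \<mu>. f \<noteq> (\<lambda>x. 0))"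

text \<open>The real vector space of all functions on a type, with pointwise operations.\<close>

interpretation function_space: vector_space "\<lambda>(c::real) (f::'a \<Rightarrow> real) x. c * f x"
  by unfold_locales (auto simp: fun_eq_iff algebra_simps)

definition dirichlet_multiplicity :: "(int ^ 'n) set \<Rightarrow> real \<Rightarrow> nat" where
  "dirichlet_multiplicity \<Omega> \<mu> = function_space.dim (dirichlet_eigenspace \<Omega> \<mu>)"

text \<open>All eigenvalues in non-decreasing order, each repeated according to its multiplicity
  (the set of eigenvalues is finite for finite \<open>\<Omega>\<close>, see below).\<close>

definition dirichlet_spectrum :: "(int ^ 'n) set \<Rightarrow> real list" where
  "dirichlet_spectrum \<Omega> =
     concat (map (\<lambda>\<mu>. replicate (dirichlet_multiplicity \<Omega> \<mu>) \<mu>)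
       (sorted_list_of_set {\<mu>. is_dirichlet_eigenvalue \<Omega> \<mu>}))"

text \<open>The numbering of the eigenvalues starts at 1.\<close>

definition dirichlet_eigenvalue :: "(int ^ 'n) set \<Rightarrow> nat \<Rightarrow> real" where
  "dirichlet_eigenvalue \<Omega> i = dirichlet_spectrum \<Omega> ! (i - 1)"


text \<open>Well-definedness of the notions above.\<close>

lemma lattice_neighbors_eq:
  fixes x :: "int ^ 'n"
  shows "lattice_neighbors x = (\<lambda>(i, s). x + axis i s) ` (UNIV \<times> {1, -1})"
proof (rule set_eqI, rule iffI)
  fix y assume "y \<in> lattice_neighbors x"
  then have s: "(\<Sum>i\<in>UNIV. \<bar>x $ i - y $ i\<bar>) = 1" by (simp add: lattice_neighbors_def)
  then have "(\<Sum>i\<in>UNIV. \<bar>x $ i - y $ i\<bar>) \<noteq> 0" by simp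
  then obtain i where i: "\<bar>x $ i - y $ i\<bar> \<noteq> 0"
    by (rule sum.not_neutral_contains_not_neutral)
  have "(\<Sum>j\<in>UNIV. \<bar>x $ j - y $ j\<bar>) = \<bar>x $ i - y $ i\<bar> + (\<Sum>j\<in>UNIV - {i}. \<bar>x $ j - y $ j\<bar>)"
    by (simp add: sum.remove)
  moreover have nn: "(\<Sum>j\<in>UNIV - {i}. \<bar>x $ j - y $ j\<bar>) \<ge> 0" by (simp add: sum_nonneg)
  ultimately have a: "\<bar>x $ i - y $ i\<bar> = 1" and z: "(\<Sum>j\<in>UNIV - {i}. \<bar>x $ j - y $ j\<bar>) = 0"
    using s i by linarith+
  have "x $ j = y $ j" if "j \<noteq> i" for j
    using z that by (subst (asm) sum_nonneg_eq_0_iff) auto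
  then have "y = x + axis i (y $ i - x $ i)"
    by (auto simp: vec_eq_iff axis_def)
  moreover have "y $ i - x $ i \<in> {1, -1}" using a by auto
  ultimately show "y \<in> (\<lambda>(i, s). x + axis i s) ` (UNIV \<times> {1, -1})" by force
next
  fix y assume "y \<in> (\<lambda>(i, s). x + axis i s) ` (UNIV \<times> {1, -1})"
  then obtain i s where y: "y = x + axis i s" and s: "s = 1 \<or> s = -1" by auto
  have "(\<Sum>j\<in>UNIV. \<bar>x $ j - y $ j\<bar>) = (\<Sum>j\<in>UNIV. if i = j then \<bar>s\<bar> else 0)"
    by (rule sum.cong) (auto simp: y axis_def)
  then show "y \<in> lattice_neighbors x" using s by (auto simp: lattice_neighbors_def)
qed

lemma finite_lattice_neighbors: "finite (lattice_neighbors x)"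
  by (simp add: lattice_neighbors_eq)

lemma lattice_degree_eq: "lattice_degree (x :: int ^ 'n) = 2 * CARD('n)"
proof -
  have "inj_on (\<lambda>(i, s). x + axis i s) (UNIV \<times> {1, -1})"
    by (auto simp: inj_on_def axis_eq_axis)
  then show ?thesis
    by (simp add: lattice_degree_def lattice_neighbors_eq card_image card_cartesian_product)
qed

lemma functions_on_span:
  assumes "finite \<Omega>"
  shows "functions_on \<Omega> \<subseteq> function_space.span ((\<lambda>z x. if x = z then 1 else 0) ` \<Omega>)"
proof
  fix f assume f: "f \<in> functions_on \<Omega>"
  have "f = (\<Sum>z\<in>\<Omega>. (\<lambda>x. f z * (if x = z then 1 else 0)))"
  proof
    fix x
    have "(\<Sum>z\<in>\<Omega>. (\<lambda>x. f z * (if x = z then 1 else 0))) x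
        = (\<Sum>z\<in>\<Omega>. f z * (if x = z then 1 else 0))"
      using assms by (induction \<Omega> rule: finite_induct) auto
    also have "\<dots> = f x"
      using f assms by (auto simp: functions_on_def if_distrib sum.delta cong: if_cong)
    finally show "f x = (\<Sum>z\<in>\<Omega>. (\<lambda>x. f z * (if x = z then 1 else 0))) x" ..
  qed
  also have "\<dots> \<in> function_space.span ((\<lambda>z x. if x = z then 1 else 0) ` \<Omega>)"
    by (intro function_space.span_sum function_space.span_scale function_space.span_base) auto
  finally show "f \<in> function_space.span ((\<lambda>z x. if x = z then 1 else 0) ` \<Omega>)" .
qed

lemma dirichlet_laplacian_sum:
  assumes "finite A"
  shows "dirichlet_laplacian \<Omega> (\<lambda>x. \<Sum>a\<in>A. c a * g a x) x
    = (\<Sum>a\<in>A. c a * dirichlet_laplacian \<Omega> (g a) x)"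
proof -
  have "zero_extension \<Omega> (\<lambda>x. \<Sum>a\<in>A. c a * g a x) y = (\<Sum>a\<in>A. c a * zero_extension \<Omega> (g a) y)" for y
    by (simp add: zero_extension_def)
  then show ?thesis
    unfolding dirichlet_laplacian_def lattice_laplacian_def
    by (simp add: sum_distrib_left right_diff_distrib sum_subtractf
        sum.swap[of _ A] mult.left_commute)
qed

text \<open>Eigenfunctions for distinct eigenvalues are linearly independent.\<close>

lemma dirichlet_eigenfunctions_indep:
  fixes g :: "real \<Rightarrow> int ^ 'n \<Rightarrow> real"
  assumes "finite A"
    and "\<And>\<mu>. \<mu> \<in> A \<Longrightarrow> g \<mu> \<in> dirichlet_eigenspace \<Omega> \<mu> \<and> g \<mu> \<noteq> (\<lambda>x. 0)"
    and "\<And>x. (\<Sum>\<mu>\<in>A. c \<mu> * g \<mu> x) = 0"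
    and "\<mu> \<in> A"
  shows "c \<mu> = 0"
  using assms
proof (induction A arbitrary: c \<mu> rule: finite_induct)
  case (insert \<nu> A)
  have ev: "dirichlet_laplacian \<Omega> (g \<mu>) x = - (\<mu> * g \<mu> x)" if "\<mu> \<in> insert \<nu> A" for \<mu> x
    using insert.prems(1)[OF that]
    by (cases "x \<in> \<Omega>")
      (auto simp: dirichlet_eigenspace_def functions_on_def dirichlet_laplacian_def minus_equation_iff)
  have "(\<Sum>\<mu>\<in>A. (c \<mu> * (\<mu> - \<nu>)) * g \<mu> x) = 0" for x
  proof -
    have "(\<lambda>x. \<Sum>\<mu>\<in>insert \<nu> A. c \<mu> * g \<mu> x) = (\<lambda>x. 0)"
      using insert.prems(2) by blast
    then have "dirichlet_laplacian \<Omega> (\<lambda>x. \<Sum>\<mu>\<in>insert \<nu> A. c \<mu> * g \<mu> x) x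
        = dirichlet_laplacian \<Omega> (\<lambda>x. 0) x"
      by simp
    then have "(\<Sum>\<mu>\<in>insert \<nu> A. c \<mu> * dirichlet_laplacian \<Omega> (g \<mu>) x) = 0"
      using insert.hyps(1)
      by (subst (asm) dirichlet_laplacian_sum)
        (auto simp: dirichlet_laplacian_def lattice_laplacian_def zero_extension_def)
    also have "(\<Sum>\<mu>\<in>insert \<nu> A. c \<mu> * dirichlet_laplacian \<Omega> (g \<mu>) x)
        = (\<Sum>\<mu>\<in>insert \<nu> A. - (c \<mu> * \<mu> * g \<mu> x))"
      by (rule sum.cong) (auto simp: ev)
    finally have 1: "(\<Sum>\<mu>\<in>insert \<nu> A. c \<mu> * \<mu> * g \<mu> x) = 0"
      by (simp add: sum_negf)
    have "(\<Sum>\<mu>\<in>insert \<nu> A. (c \<mu> * (\<mu> - \<nu>)) * g \<mu> x)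
        = (\<Sum>\<mu>\<in>insert \<nu> A. c \<mu> * \<mu> * g \<mu> x) - \<nu> * (\<Sum>\<mu>\<in>insert \<nu> A. c \<mu> * g \<mu> x)"
      unfolding sum_distrib_left sum_subtractf[symmetric]
      by (rule sum.cong) (auto simp: algebra_simps)
    also have "\<dots> = 0" using 1 insert.prems(2)[of x] by simp
    finally show ?thesis using insert.hyps by simp
  qed
  then have "c \<mu> * (\<mu> - \<nu>) = 0" if "\<mu> \<in> A" for \<mu>
    using insert.IH[of "\<lambda>\<mu>. c \<mu> * (\<mu> - \<nu>)" \<mu>] insert.prems(1) that by blast
  then have cA: "c \<mu> = 0" if "\<mu> \<in> A" for \<mu>
    using that insert.hyps(2) by fastforce
  obtain x where "g \<nu> x \<noteq> 0" using insert.prems(1)[of \<nu>] by auto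
  moreover have "c \<nu> * g \<nu> x = 0"
    using insert.prems(2)[of x] insert.hyps cA by simp
  ultimately show ?case using cA insert.prems(3) by auto
qed simp

lemma finite_dirichlet_eigenvalues:
  assumes "finite \<Omega>"
  shows "finite {\<mu>. is_dirichlet_eigenvalue \<Omega> \<mu>}"
proof (rule ccontr)
  assume inf: "infinite {\<mu>. is_dirichlet_eigenvalue \<Omega> \<mu>}"
  obtain A where A: "A \<subseteq> {\<mu>. is_dirichlet_eigenvalue \<Omega> \<mu>}" "finite A" "card A = Suc (card \<Omega>)"
    using infinite_arbitrarily_large[OF inf] by metis
  have "\<forall>\<mu>\<in>A. \<exists>f. f \<in> dirichlet_eigenspace \<Omega> \<mu> \<and> f \<noteq> (\<lambda>x. 0)"
    using A(1) by (auto simp: is_dirichlet_eigenvalue_def)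
  then obtain g where g: "\<And>\<mu>. \<mu> \<in> A \<Longrightarrow> g \<mu> \<in> dirichlet_eigenspace \<Omega> \<mu> \<and> g \<mu> \<noteq> (\<lambda>x. 0)"
    by metis
  have inj: "inj_on g A"
  proof (rule inj_onI, rule ccontr)
    fix a b assume ab: "a \<in> A" "b \<in> A" "g a = g b" "a \<noteq> b"
    have "(1::real) = 0"
      using dirichlet_eigenfunctions_indep[of "{a, b}" g \<Omega> "\<lambda>\<mu>. if \<mu> = a then 1 else -1" a] g ab
      by auto
    then show False by simp
  qed
  have "function_space.independent (g ` A)"
  proof (rule function_space.independent_if_scalars_zero)
    fix u f assume "(\<Sum>f\<in>g ` A. (\<lambda>x. u f * f x)) = 0" and f: "f \<in> g ` A"
    then have s: "(\<Sum>\<mu>\<in>A. (\<lambda>x. u (g \<mu>) * g \<mu> x)) = 0"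
      by (simp add: sum.reindex[OF inj] o_def)
    have "(\<Sum>\<mu>\<in>A. (\<lambda>x. u (g \<mu>) * g \<mu> x)) x = (\<Sum>\<mu>\<in>A. u (g \<mu>) * g \<mu> x)" for x
      using A(2) by (induction A rule: finite_induct) auto
    then have "(\<Sum>\<mu>\<in>A. u (g \<mu>) * g \<mu> x) = 0" for x
      using s by (metis zero_fun_apply)
    then show "u f = 0"
      using dirichlet_eigenfunctions_indep[OF A(2) g, of "\<lambda>\<mu>. u (g \<mu>)"] f by auto
  qed (use A in auto)
  moreover have "g ` A \<subseteq> function_space.span ((\<lambda>z x. if x = z then 1 else 0) ` \<Omega>)"
    using g functions_on_span[OF assms] by (auto simp: dirichlet_eigenspace_def)
  ultimately have "card (g ` A) \<le> card ((\<lambda>z x. if x = z then 1 else (0::real)) ` \<Omega>)"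
    using function_space.independent_span_bound assms by blast
  also have "\<dots> \<le> card \<Omega>" using assms by (rule card_image_le)
  finally show False using A(3) by (simp add: card_image[OF inj])
qed

end

theory Submission
  imports Defs
begin

text \<open>
  Let \<open>L = -\<Delta>\<^sub>\<Omega>\<close> with orthonormal eigenfunctions \<open>u\<^sub>i\<close> and put
  \<open>a\<^sub>i\<^sub>j = \<langle>x\<^sub>\<alpha> u\<^sub>i, u\<^sub>j\<rangle>\<close> for a coordinate \<open>x\<^sub>\<alpha>\<close>. The commutator \<open>[L, x\<^sub>\<alpha>]\<close> is minus the central
  difference in direction \<open>\<alpha>\<close> and has matrix entries \<open>(\<lambda>\<^sub>j - \<lambda>\<^sub>i) a\<^sub>i\<^sub>j\<close>; the double commutators
  with the \<open>x\<^sub>\<alpha>\<close> sum to \<open>I - L\<close>. Since \<open>a\<close> is symmetric, comparing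
  \<open>\<Sum>\<^sub>j (\<lambda>\<^sub>j - \<lambda>\<^sub>i) a\<^sub>i\<^sub>j\<^sup>2\<close> with \<open>\<Sum>\<^sub>j (\<lambda>\<^sub>j - \<lambda>\<^sub>i)\<^sup>2 a\<^sub>i\<^sub>j\<^sup>2\<close> and summing over \<open>\<alpha>\<close> yields Yang's inequality
  \<open>\<Sum>\<^sub>i (\<lambda>\<^sub>k\<^sub>+\<^sub>1 - \<lambda>\<^sub>i)\<^sup>2 (1 - \<lambda>\<^sub>i) \<le> 4/n \<Sum>\<^sub>i (\<lambda>\<^sub>k\<^sub>+\<^sub>1 - \<lambda>\<^sub>i) \<lambda>\<^sub>i\<close> over \<open>i \<le> k\<close>.

  If \<open>\<lambda>\<^sub>k \<le> 1 - \<delta>\<close>, set \<open>a = 2/(n\<delta>)\<close> and let \<open>F\<^sub>j\<close> be \<open>(1 + a)\<close> times the squared mean of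
  \<open>\<lambda>\<^sub>1, \<dots>, \<lambda>\<^sub>j\<close> minus the mean of their squares. Following Cheng and Yang, the inequality gives both
  \<open>F\<^sub>j\<^sub>+\<^sub>1 \<le> ((j+1)/j)\<^sup>2\<^sup>a F\<^sub>j\<close> and \<open>a \<lambda>\<^sub>k\<^sub>+\<^sub>1\<^sup>2 \<le> (1 + 2a)\<^sup>2 F\<^sub>k\<close>, whence the bound, as \<open>F\<^sub>1 = a \<lambda>\<^sub>1\<^sup>2\<close>.
\<close>

section \<open>Orthonormal functions\<close>

text \<open>The weight d_x is omitted: it is the constant 2n on the lattice, so orthogonality and
  eigenvalues are unaffected.\<close>

definition fn_inner :: "'a set \<Rightarrow> ('a \<Rightarrow> real) \<Rightarrow> ('a \<Rightarrow> real) \<Rightarrow> real" where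
  "fn_inner S f g = (\<Sum>x\<in>S. f x * g x)"

definition orthonormal_fns :: "'a set \<Rightarrow> ('a \<Rightarrow> real) set \<Rightarrow> bool" where
  "orthonormal_fns S B \<longleftrightarrow> (\<forall>f\<in>B. \<forall>g\<in>B. fn_inner S f g = (if f = g then 1 else 0))"

lemma fn_inner_commute: "fn_inner S f g = fn_inner S g f"
  by (simp add: fn_inner_def mult.commute)

lemma fn_inner_nonneg: "0 \<le> fn_inner S f f"
  by (simp add: fn_inner_def sum_nonneg)

lemma fn_inner_self_eq_0_iff:
  assumes "finite S"
  shows "fn_inner S f f = 0 \<longleftrightarrow> (\<forall>x\<in>S. f x = 0)"
  using assms by (simp add: fn_inner_def sum_nonneg_eq_0_iff)

lemma fn_inner_add_left: "fn_inner S (\<lambda>x. f x + h x) g = fn_inner S f g + fn_inner S h g"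
  by (simp add: fn_inner_def sum.distrib algebra_simps)

lemma fn_inner_diff_left: "fn_inner S (\<lambda>x. f x - h x) g = fn_inner S f g - fn_inner S h g"
  by (simp add: fn_inner_def sum_subtractf algebra_simps)

lemma fn_inner_scale_left: "fn_inner S (\<lambda>x. c * f x) g = c * fn_inner S f g"
  by (simp add: fn_inner_def sum_distrib_left mult.assoc)

lemma fn_inner_sum_left:
  "fn_inner S (\<lambda>x. \<Sum>b\<in>B. h b x) g = (\<Sum>b\<in>B. fn_inner S (h b) g)"
  unfolding fn_inner_def sum_distrib_right by (rule sum.swap)

lemmas fn_inner_left = fn_inner_add_left fn_inner_diff_left fn_inner_scale_left fn_inner_sum_left

lemma fn_inner_right:
  "fn_inner S g (\<lambda>x. f x + h x) = fn_inner S g f + fn_inner S g h"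
  "fn_inner S g (\<lambda>x. c * f x) = c * fn_inner S g f"
  by (simp_all add: fn_inner_commute[of S g] fn_inner_left)

lemma orthonormal_sum:
  assumes B: "finite B" "orthonormal_fns S B" and b: "b \<in> B"
  shows "(\<Sum>c\<in>B. u c * fn_inner S c b) = u b"
proof -
  have "(\<Sum>c\<in>B. u c * fn_inner S c b) = (\<Sum>c\<in>B. if c = b then u b else 0)"
    using B(2) b by (intro sum.cong) (auto simp: orthonormal_fns_def)
  then show ?thesis using B(1) b by simp
qed

definition residue_fn :: "'a set \<Rightarrow> ('a \<Rightarrow> real) set \<Rightarrow> ('a \<Rightarrow> real) \<Rightarrow> 'a \<Rightarrow> real" where
  "residue_fn S B f = (\<lambda>x. f x - (\<Sum>b\<in>B. fn_inner S f b * b x))"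

lemma residue_fn_orthogonal:
  assumes "finite B" "orthonormal_fns S B" "b \<in> B"
  shows "fn_inner S (residue_fn S B f) b = 0"
  by (simp add: residue_fn_def fn_inner_left orthonormal_sum[OF assms])

lemma fn_inner_residue_fn:
  "fn_inner S (residue_fn S B f) g = fn_inner S f g - (\<Sum>b\<in>B. fn_inner S f b * fn_inner S g b)"
  unfolding residue_fn_def fn_inner_left fn_inner_commute[of S g] by (rule refl)

lemma bessel_inequality:
  assumes B: "finite B" "orthonormal_fns S B"
  shows "(\<Sum>b\<in>B. (fn_inner S f b)^2) \<le> fn_inner S f f"
proof -
  let ?r = "residue_fn S B f"
  have "fn_inner S ?r ?r = fn_inner S f ?r"
    by (subst fn_inner_residue_fn) (simp add: residue_fn_orthogonal[OF B])
  also have "\<dots> = fn_inner S f f - (\<Sum>b\<in>B. (fn_inner S f b)^2)"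
    by (simp add: fn_inner_commute[of S f ?r] fn_inner_residue_fn power2_eq_square)
  finally show ?thesis using fn_inner_nonneg[of S ?r] by linarith
qed

lemma fn_inner_indicator:
  assumes "finite S" "x \<in> S"
  shows "fn_inner S (\<lambda>y. if y = x then 1 else 0) f = f x"
proof -
  have "(if y = x then 1 else 0) * f y = (if y = x then f y else 0)" for y by simp
  then show ?thesis using assms by (simp add: fn_inner_def)
qed

text \<open>The inner sum is the diagonal entry at \<open>x\<close> of the orthogonal projection
  onto the span of \<open>B\<close>, whose trace counts \<open>B\<close>. Bessel's inequality turns
  this into \<open>card B \<le> card S\<close>, completeness into equality.\<close>

lemma sum_fn_inner_indicator:
  assumes S: "finite S" and B: "orthonormal_fns S B"
  shows "(\<Sum>x\<in>S. \<Sum>b\<in>B. (fn_inner S (\<lambda>y. if y = x then 1 else 0) b)^2) = real (card B)"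
proof -
  have "(\<Sum>x\<in>S. \<Sum>b\<in>B. (fn_inner S (\<lambda>y. if y = x then 1 else 0) b)^2)
      = (\<Sum>x\<in>S. \<Sum>b\<in>B. b x * b x)"
    using S by (simp add: fn_inner_indicator power2_eq_square)
  also have "\<dots> = (\<Sum>b\<in>B. fn_inner S b b)"
    unfolding fn_inner_def by (rule sum.swap)
  also have "\<dots> = real (card B)" using B by (simp add: orthonormal_fns_def)
  finally show ?thesis .
qed

lemma card_orthonormal_le:
  assumes S: "finite S" and B: "finite B" "orthonormal_fns S B"
  shows "card B \<le> card S"
proof -
  have "(\<Sum>b\<in>B. (fn_inner S (\<lambda>y. if y = x then 1 else 0) b)^2) \<le> 1" if "x \<in> S" for x
    using bessel_inequality[OF B, of "\<lambda>y. if y = x then 1 else 0"] fn_inner_indicator[OF S that]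
    by simp
  then have "real (card B) \<le> (\<Sum>x\<in>S. 1)"
    unfolding sum_fn_inner_indicator[OF S B(2), symmetric] by (rule sum_mono)
  then show ?thesis by simp
qed

lemma orthonormal_coefficient_zero:
  assumes B: "finite B" "orthonormal_fns S B" and b: "b \<in> B"
    and z: "\<And>x. (\<Sum>c\<in>B. u c * c x) = 0"
  shows "u b = 0"
proof -
  have "0 = fn_inner S (\<lambda>x. \<Sum>c\<in>B. u c * c x) b" using z by (simp add: fn_inner_def)
  then show ?thesis by (simp add: fn_inner_left orthonormal_sum[OF B b])
qed

section \<open>The spectrum of the Dirichlet Laplacian\<close>

lemma sum_lattice_neighbors:
  fixes x :: "int ^ 'n"
  shows "(\<Sum>y\<in>lattice_neighbors x. f y) = (\<Sum>i\<in>UNIV. f (x + axis i 1) + f (x - axis i 1))"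
proof -
  have inj: "inj_on (\<lambda>(i, s). x + axis i s) (UNIV \<times> {1, -1})"
    by (auto simp: inj_on_def axis_eq_axis)
  have m: "axis i (-1) = - axis i (1::int)" for i :: 'n
    by (simp add: vec_eq_iff axis_def)
  have "(\<Sum>y\<in>lattice_neighbors x. f y) = (\<Sum>(i, s)\<in>UNIV \<times> {1, -1}. f (x + axis i s))"
    unfolding lattice_neighbors_eq by (subst sum.reindex[OF inj]) (simp add: o_def case_prod_unfold)
  also have "\<dots> = (\<Sum>i\<in>UNIV. \<Sum>s\<in>{1, -1}. f (x + axis i s))"
    by (rule sum.cartesian_product[symmetric])
  finally show ?thesis by (simp add: m)
qed

lemma minus_dirichlet_laplacian_eq:
  fixes \<Omega> :: "(int ^ 'n) set"
  assumes "f \<in> functions_on \<Omega>" "x \<in> \<Omega>"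
  shows "- dirichlet_laplacian \<Omega> f x
    = f x - 1 / (2 * real CARD('n)) * (\<Sum>i\<in>UNIV. f (x + axis i 1) + f (x - axis i 1))"
proof -
  have "zero_extension \<Omega> f = f"
    using assms(1) by (auto simp: zero_extension_def functions_on_def)
  then show ?thesis
    using assms(2)
    by (simp add: dirichlet_laplacian_def lattice_laplacian_def lattice_degree_eq sum_lattice_neighbors)
qed

text \<open>Summation by parts: both sums live on the points that have their translate in
  \<open>\<Omega>\<close> too, since \<open>f\<close> and \<open>g\<close> vanish elsewhere; no
  boundary terms arise.\<close>

lemma sum_shift:
  fixes f g :: "int ^ 'n \<Rightarrow> real"
  assumes "finite \<Omega>" "f \<in> functions_on \<Omega>" "g \<in> functions_on \<Omega>"
  shows "(\<Sum>x\<in>\<Omega>. f x * g (x - e)) = (\<Sum>x\<in>\<Omega>. f (x + e) * g x)"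
proof -
  have "(\<Sum>x\<in>\<Omega>. f x * g (x - e)) = (\<Sum>x\<in>{x\<in>\<Omega>. x - e \<in> \<Omega>}. f x * g (x - e))"
    using assms by (intro sum.mono_neutral_right) (auto simp: functions_on_def)
  also have "\<dots> = (\<Sum>x\<in>{x\<in>\<Omega>. x + e \<in> \<Omega>}. f (x + e) * g x)"
    by (rule sum.reindex_bij_witness[where i = "\<lambda>x. x + e" and j = "\<lambda>x. x - e"]) auto
  also have "\<dots> = (\<Sum>x\<in>\<Omega>. f (x + e) * g x)"
    using assms by (intro sum.mono_neutral_left) (auto simp: functions_on_def)
  finally show ?thesis .
qed

lemma minus_dirichlet_laplacian_symmetric:
  fixes \<Omega> :: "(int ^ 'n) set"
  assumes "finite \<Omega>" "f \<in> functions_on \<Omega>" "g \<in> functions_on \<Omega>"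
  shows "fn_inner \<Omega> (\<lambda>x. - dirichlet_laplacian \<Omega> f x) g = fn_inner \<Omega> f (\<lambda>x. - dirichlet_laplacian \<Omega> g x)"
proof -
  define c where "c = 1 / (2 * real CARD('n))"
  have *: "fn_inner \<Omega> (\<lambda>x. - dirichlet_laplacian \<Omega> f x) g = fn_inner \<Omega> f g
      - c * (\<Sum>i\<in>UNIV. (\<Sum>x\<in>\<Omega>. f (x + axis i 1) * g x) + (\<Sum>x\<in>\<Omega>. f (x - axis i 1) * g x))"
    if "f \<in> functions_on \<Omega>" for f g
  proof -
    have "fn_inner \<Omega> (\<lambda>x. - dirichlet_laplacian \<Omega> f x) g
        = (\<Sum>x\<in>\<Omega>. (f x - c * (\<Sum>i\<in>UNIV. f (x + axis i 1) + f (x - axis i 1))) * g x)"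
      unfolding fn_inner_def c_def using minus_dirichlet_laplacian_eq[OF that] by simp
    also have "\<dots> = fn_inner \<Omega> f g
        - c * (\<Sum>x\<in>\<Omega>. \<Sum>i\<in>UNIV. f (x + axis i 1) * g x + f (x - axis i 1) * g x)"
      by (simp add: left_diff_distrib sum_subtractf fn_inner_def sum_distrib_left sum_distrib_right
          algebra_simps)
    finally show ?thesis by (simp add: sum.swap[of _ \<Omega>] sum.distrib)
  qed
  \<comment> \<open>Each direction contributes a forward and a backward shift, which are adjoint to
    each other.\<close>
  have sh: "(\<Sum>x\<in>\<Omega>. f (x + e) * g x) + (\<Sum>x\<in>\<Omega>. f (x - e) * g x)
      = (\<Sum>x\<in>\<Omega>. g (x + e) * f x) + (\<Sum>x\<in>\<Omega>. g (x - e) * f x)" for e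
    using sum_shift[OF assms, of e] sum_shift[OF assms(1,3,2), of e] by (simp add: mult.commute)
  show ?thesis
    unfolding fn_inner_commute[of \<Omega> f "\<lambda>x. - dirichlet_laplacian \<Omega> g x"]
      *[OF assms(2)] *[OF assms(3)] sh fn_inner_commute[of \<Omega> g f] by (rule refl)
qed

lemma minus_dirichlet_laplacian_in_functions_on [simp]:
  "(\<lambda>x. - dirichlet_laplacian \<Omega> f x) \<in> functions_on \<Omega>"
  by (simp add: functions_on_def dirichlet_laplacian_def)

lemma dirichlet_laplacian_add_scaled:
  "dirichlet_laplacian \<Omega> (\<lambda>x. f x + t * h x) x
    = dirichlet_laplacian \<Omega> f x + t * dirichlet_laplacian \<Omega> h x"
proof -
  have "zero_extension \<Omega> (\<lambda>x. f x + t * h x) y = zero_extension \<Omega> f y + t * zero_extension \<Omega> h y" for y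
    by (simp add: zero_extension_def)
  then show ?thesis
    by (simp add: dirichlet_laplacian_def lattice_laplacian_def sum.distrib sum_distrib_left algebra_simps)
qed

lemma dirichlet_laplacian_zero [simp]: "dirichlet_laplacian \<Omega> (\<lambda>x. 0) x = 0"
  by (simp add: dirichlet_laplacian_def lattice_laplacian_def zero_extension_def)

section \<open>Eigenfunctions from the Rayleigh quotient\<close>

lemma compact_functions_on_box:
  "compact {f \<in> functions_on \<Omega>. \<forall>x. \<bar>f x\<bar> \<le> 1}"
proof -
  let ?I = "\<lambda>x. if x \<in> \<Omega> then {-1..1::real} else {0}"
  \<comment> \<open>Tychonoff: functions carry the product topology, and a point outside
    \<open>\<Omega>\<close> contributes the factor \<open>{0}\<close>.\<close>
  have "compactin (product_topology (\<lambda>_. euclidean) UNIV) (\<Pi>\<^sub>E x\<in>UNIV. ?I x)"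
    by (subst compactin_PiE) auto
  moreover have "(\<Pi>\<^sub>E x\<in>UNIV. ?I x) = {f \<in> functions_on \<Omega>. \<forall>x. \<bar>f x\<bar> \<le> 1}"
    by (auto simp: PiE_def Pi_def functions_on_def abs_le_iff split: if_splits)
       (smt (verit))+
  ultimately show ?thesis
    by (simp add: euclidean_product_topology compactin_euclidean_iff)
qed

lemma continuous_on_coordinate [continuous_intros]:
  "continuous_on A (\<lambda>f :: 'a \<Rightarrow> real. f x)"
  by (rule continuous_on_subset[OF continuous_on_product_coordinates]) simp

lemma continuous_on_dirichlet_laplacian [continuous_intros]:
  "continuous_on A (\<lambda>f. dirichlet_laplacian \<Omega> f x)"
proof -
  have "continuous_on A (\<lambda>f. zero_extension \<Omega> f y)" for y
    by (cases "y \<in> \<Omega>") (auto simp: zero_extension_def intro!: continuous_intros)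
  then show ?thesis
    by (cases "x \<in> \<Omega>")
      (auto simp: dirichlet_laplacian_def lattice_laplacian_def lattice_degree_eq intro!: continuous_intros)
qed

text \<open>The eigenfunction is a minimiser \<open>f\<close> of the Rayleigh quotient on the orthogonal complement of
  \<open>B\<close>, varied in the direction of its own residue \<open>h = L f - m f\<close>.\<close>

lemma exists_dirichlet_eigenfunction_orthogonal:
  assumes \<Omega>: "finite \<Omega>"
    and B: "\<And>b. b \<in> B \<Longrightarrow> \<exists>\<mu>. b \<in> dirichlet_eigenspace \<Omega> \<mu>"
    and g: "g \<in> functions_on \<Omega>" "fn_inner \<Omega> g g \<noteq> 0" "\<And>b. b \<in> B \<Longrightarrow> fn_inner \<Omega> g b = 0"
  obtains f \<mu> where "f \<in> dirichlet_eigenspace \<Omega> \<mu>" "fn_inner \<Omega> f f = 1"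
    "\<And>b. b \<in> B \<Longrightarrow> fn_inner \<Omega> f b = 0"
proof -
  define V where "V = {f \<in> functions_on \<Omega>. \<forall>b\<in>B. fn_inner \<Omega> f b = 0}"
  define K where "K = {f \<in> V. fn_inner \<Omega> f f = 1}"
  define L where "L f = (\<lambda>x. - dirichlet_laplacian \<Omega> f x)" for f
  define Q where "Q f = fn_inner \<Omega> (L f) f" for f
  have cont: "continuous_on A (\<lambda>f. fn_inner \<Omega> f f)" "continuous_on A (\<lambda>f. fn_inner \<Omega> f b)"
    "continuous_on A Q" for A b
    unfolding Q_def L_def fn_inner_def by (intro continuous_intros)+
  have L_lin: "L (\<lambda>x. f x + t * h x) = (\<lambda>x. L f x + t * L h x)" for f t h
    by (simp add: L_def dirichlet_laplacian_add_scaled)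
  have L_sym: "fn_inner \<Omega> (L f) h = fn_inner \<Omega> f (L h)" if "f \<in> V" "h \<in> V" for f h
    using minus_dirichlet_laplacian_symmetric[OF \<Omega>] that by (simp add: L_def V_def)
  have V_lin: "(\<lambda>x. f x + t * h x) \<in> V" if "f \<in> V" "h \<in> V" for f t h
    using that by (auto simp: V_def functions_on_def fn_inner_left)
  \<comment> \<open>As \<open>B\<close> consists of eigenfunctions and \<open>L\<close> is
    symmetric, the orthogonal complement of \<open>B\<close> is invariant; this keeps the variation
    \<open>h\<close> admissible.\<close>
  have V_L: "L f \<in> V" if f: "f \<in> V" for f
  proof -
    have "fn_inner \<Omega> (L f) b = 0" if b: "b \<in> B" for b
    proof -
      obtain \<mu> where \<mu>: "b \<in> dirichlet_eigenspace \<Omega> \<mu>" using B[OF b] by blast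
      have "fn_inner \<Omega> (L f) b = fn_inner \<Omega> f (L b)"
        using minus_dirichlet_laplacian_symmetric[OF \<Omega>] \<mu> f
        by (simp add: L_def V_def dirichlet_eigenspace_def)
      also have "\<dots> = fn_inner \<Omega> (\<lambda>x. \<mu> * b x) f"
        using \<mu> by (auto simp: fn_inner_def L_def dirichlet_eigenspace_def intro!: sum.cong)
      also have "\<dots> = 0"
        using f b by (simp add: fn_inner_left fn_inner_commute[of \<Omega> b f] V_def)
      finally show ?thesis .
    qed
    then show ?thesis by (simp add: V_def L_def)
  qed
  have "K = {f \<in> functions_on \<Omega>. \<forall>x. \<bar>f x\<bar> \<le> 1}
      \<inter> ((\<Inter>b\<in>B. {f. fn_inner \<Omega> f b = 0}) \<inter> {f. fn_inner \<Omega> f f = 1})"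
  proof -
    have "\<bar>f x\<bar> \<le> 1" if "f \<in> functions_on \<Omega>" "fn_inner \<Omega> f f = 1" for f x
    proof (cases "x \<in> \<Omega>")
      case True
      have "f x * f x \<le> fn_inner \<Omega> f f"
        unfolding fn_inner_def using True \<Omega> by (intro member_le_sum) auto
      then have "(f x)^2 \<le> 1" using that by (simp add: power2_eq_square)
      then show ?thesis by (simp only: abs_square_le_1)
    qed (use that in \<open>simp add: functions_on_def\<close>)
    then show ?thesis by (auto simp: K_def V_def)
  qed
  moreover have "closed ((\<Inter>b\<in>B. {f. fn_inner \<Omega> f b = 0}) \<inter> {f. fn_inner \<Omega> f f = 1})"
    by (intro closed_Int closed_INT ballI closed_Collect_eq cont continuous_on_const)
  ultimately have "compact K"
    by (simp only: compact_Int_closed compact_functions_on_box)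
  \<comment> \<open>The summand 0 brings the scaling into the form covered by \<open>V_lin\<close>
    and \<open>L_lin\<close>.\<close>
  have normalise: "(\<lambda>x. 0 + (1 / sqrt (fn_inner \<Omega> h h)) * h x) \<in> K"
    if "h \<in> V" "fn_inner \<Omega> h h \<noteq> 0" for h
  proof -
    define c where "c = 1 / sqrt (fn_inner \<Omega> h h)"
    have "(\<lambda>x. 0) \<in> V" by (simp add: V_def functions_on_def fn_inner_def)
    then have "(\<lambda>x. 0 + c * h x) \<in> V" using V_lin that by blast
    moreover have "c^2 * fn_inner \<Omega> h h = 1"
      using that fn_inner_nonneg[of \<Omega> h] by (simp add: c_def power_divide)
    ultimately show ?thesis
      unfolding c_def[symmetric] by (simp add: K_def fn_inner_left fn_inner_right power2_eq_square)
  qed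
  have "K \<noteq> {}" using normalise[of g] g by (auto simp: V_def)
  then obtain f where f: "f \<in> K" and fmin: "\<And>h. h \<in> K \<Longrightarrow> Q f \<le> Q h"
    using continuous_attains_inf[OF \<open>compact K\<close> _ cont(3)] by blast
  define m where "m = Q f"
  have Qm: "m * fn_inner \<Omega> h h \<le> Q h" if h: "h \<in> V" for h
  proof (cases "fn_inner \<Omega> h h = 0")
    case True
    then have "\<forall>x\<in>\<Omega>. h x = 0" using fn_inner_self_eq_0_iff[OF \<Omega>] by blast
    then show ?thesis using True by (simp add: Q_def fn_inner_def)
  next
    case False
    then have pos: "fn_inner \<Omega> h h > 0" using fn_inner_nonneg[of \<Omega> h] by linarith
    have "L (\<lambda>x. 0 + c * h x) = (\<lambda>x. 0 + c * L h x)" for c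
      unfolding L_lin by (simp add: L_def)
    then have "Q (\<lambda>x. 0 + c * h x) = c^2 * Q h" for c
      by (simp add: Q_def fn_inner_left fn_inner_right power2_eq_square)
    then have "m \<le> (1 / sqrt (fn_inner \<Omega> h h))^2 * Q h"
      using fmin[OF normalise[OF h False]] unfolding m_def by (simp only:)
    then show ?thesis using pos by (simp add: power_divide field_simps)
  qed
  define h where "h = (\<lambda>x. L f x + (-m) * f x)"
  have fV: "f \<in> V" and f1: "fn_inner \<Omega> f f = 1" using f by (auto simp: K_def)
  have hV: "h \<in> V" unfolding h_def using V_lin V_L fV by blast
  define H where "H = fn_inner \<Omega> h h"
  define c where "c = Q h - m * H"
  have c: "c \<ge> 0" using Qm[OF hV] by (simp add: c_def H_def)
  \<comment> \<open>\<open>Q\<close> minus \<open>m\<close> times the squared norm is nonnegative on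
    \<open>V\<close> and vanishes at \<open>f\<close>. Along \<open>f + t * h\<close> it is this
    quadratic in \<open>t\<close>; its linear coefficient is \<open>2 * H\<close> because
    \<open>L f - m * f\<close> is \<open>h\<close> itself.\<close>
  have var: "0 \<le> 2 * t * H + t^2 * c" for t
  proof -
    have "fn_inner \<Omega> f (L h) = fn_inner \<Omega> (L f) h" using L_sym fV hV by simp
    then have qe: "Q (\<lambda>x. f x + t * h x) = m + 2 * t * fn_inner \<Omega> (L f) h + t^2 * Q h"
      unfolding Q_def L_lin m_def
      by (simp add: fn_inner_left fn_inner_right power2_eq_square fn_inner_commute[of \<Omega> "L h" f]
          algebra_simps)
    have ne: "fn_inner \<Omega> (\<lambda>x. f x + t * h x) (\<lambda>x. f x + t * h x)
        = 1 + 2 * t * fn_inner \<Omega> f h + t^2 * H"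
      by (simp add: fn_inner_left fn_inner_right power2_eq_square f1 H_def
          fn_inner_commute[of \<Omega> h f] algebra_simps)
    have "fn_inner \<Omega> h g = fn_inner \<Omega> (L f) g - m * fn_inner \<Omega> f g" for g
      by (simp add: h_def fn_inner_left)
    then have he: "fn_inner \<Omega> (L f) h = H + m * fn_inner \<Omega> f h" by (simp add: H_def)
    show ?thesis
      using Qm[OF V_lin[OF fV hV, of t]] unfolding qe ne he c_def by (simp add: algebra_simps)
  qed
  have "H = 0"
  proof (rule ccontr)
    assume "H \<noteq> 0"
    \<comment> \<open>This \<open>t\<close> makes the quadratic equal to
      \<open>- (t^2 * (c + 2))\<close>, which is negative; the added 1 keeps the denominator
      positive when \<open>c = 0\<close>.\<close>
    define t where "t = - H / (c + 1)"
    have t: "t \<noteq> 0" "H = - ((c + 1) * t)" using c \<open>H \<noteq> 0\<close> by (auto simp: t_def)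
    have "2 * t * H + t^2 * c = - (t^2 * (c + 2))"
      unfolding t(2) by (simp add: power2_eq_square algebra_simps)
    moreover have "t^2 * (c + 2) > 0" using c t(1) by simp
    ultimately show False using var[of t] by linarith
  qed
  then have "\<forall>x\<in>\<Omega>. h x = 0" using fn_inner_self_eq_0_iff[OF \<Omega>] by (simp add: H_def)
  then have "f \<in> dirichlet_eigenspace \<Omega> m"
    using fV by (auto simp: dirichlet_eigenspace_def V_def h_def L_def)
  then show ?thesis using that fV f1 by (auto simp: V_def)
qed

section \<open>A complete orthonormal eigenbasis\<close>

definition dirichlet_eigenbasis ::
    "(int ^ 'n) set \<Rightarrow> (int ^ 'n \<Rightarrow> real) set \<Rightarrow> ((int ^ 'n \<Rightarrow> real) \<Rightarrow> real) \<Rightarrow> bool" where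
  "dirichlet_eigenbasis \<Omega> B ev \<longleftrightarrow> finite B \<and> orthonormal_fns \<Omega> B \<and> card B = card \<Omega> \<and>
     (\<forall>b\<in>B. b \<in> dirichlet_eigenspace \<Omega> (ev b)) \<and>
     (\<forall>f\<in>functions_on \<Omega>. \<forall>x. f x = (\<Sum>b\<in>B. fn_inner \<Omega> f b * b x))"

text \<open>Take an orthonormal set of eigenfunctions of greatest size. A function on
  \<open>\<Omega>\<close> with nonzero residue would yield a further eigenfunction orthogonal to the
  set.\<close>

lemma exists_dirichlet_eigenbasis:
  assumes \<Omega>: "finite \<Omega>"
  obtains B ev where "dirichlet_eigenbasis \<Omega> B ev"
proof -
  define P where "P B \<longleftrightarrow> finite B \<and> orthonormal_fns \<Omega> B \<and> (\<forall>b\<in>B. \<exists>\<mu>. b \<in> dirichlet_eigenspace \<Omega> \<mu>)" for B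
  have "P {}" by (simp add: P_def orthonormal_fns_def)
  moreover have "\<forall>B. P B \<longrightarrow> card B \<le> card \<Omega>" using card_orthonormal_le[OF \<Omega>] by (auto simp: P_def)
  ultimately obtain B where PB: "P B" and max: "\<And>B'. P B' \<Longrightarrow> card B' \<le> card B"
    using ex_has_greatest_nat[of P "{}" card "Suc (card \<Omega>)"] unfolding less_Suc_eq_le by metis
  then have B: "finite B" "orthonormal_fns \<Omega> B" and eig: "\<And>b. b \<in> B \<Longrightarrow> \<exists>\<mu>. b \<in> dirichlet_eigenspace \<Omega> \<mu>"
    by (auto simp: P_def)
  have supp: "b x = 0" if "b \<in> B" "x \<notin> \<Omega>" for b x
    using eig[OF that(1)] that(2) by (auto simp: dirichlet_eigenspace_def functions_on_def)
  have complete: "f x = (\<Sum>b\<in>B. fn_inner \<Omega> f b * b x)" if f: "f \<in> functions_on \<Omega>" for f x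
  proof -
    let ?r = "residue_fn \<Omega> B f"
    have r: "?r \<in> functions_on \<Omega>"
      using f supp by (auto simp: residue_fn_def functions_on_def intro!: sum.neutral)
    have "fn_inner \<Omega> ?r ?r = 0"
    proof (rule ccontr)
      assume r0: "fn_inner \<Omega> ?r ?r \<noteq> 0"
      obtain u \<mu> where u: "u \<in> dirichlet_eigenspace \<Omega> \<mu>" "fn_inner \<Omega> u u = 1"
          "\<And>b. b \<in> B \<Longrightarrow> fn_inner \<Omega> u b = 0"
        using exists_dirichlet_eigenfunction_orthogonal[OF \<Omega> eig r r0 residue_fn_orthogonal[OF B]] by blast
      then have "u \<notin> B" by auto
      have "fn_inner \<Omega> b u = 0" if "b \<in> B" for b
        using u(3)[OF that] by (simp add: fn_inner_commute)
      then have "P (insert u B)"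
        using B eig u \<open>u \<notin> B\<close> by (auto simp: P_def orthonormal_fns_def)
      then show False using max[of "insert u B"] B(1) \<open>u \<notin> B\<close> by simp
    qed
    then have "?r x = 0"
      using fn_inner_self_eq_0_iff[OF \<Omega>] r by (cases "x \<in> \<Omega>") (auto simp: functions_on_def)
    then show ?thesis by (simp add: residue_fn_def)
  qed
  \<comment> \<open>Completeness makes every diagonal entry of the projection onto the span of
    \<open>B\<close> equal to 1, so its trace is both \<open>card B\<close> and
    \<open>card \<Omega>\<close>.\<close>
  have "(\<Sum>b\<in>B. (fn_inner \<Omega> (\<lambda>y. if y = x then 1 else 0) b)^2) = 1" if x: "x \<in> \<Omega>" for x
  proof -
    have "(\<lambda>y. if y = x then 1 else 0) \<in> functions_on \<Omega>" using x by (auto simp: functions_on_def)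
    from complete[OF this, of x] show ?thesis
      using fn_inner_indicator[OF \<Omega> x] by (simp add: power2_eq_square)
  qed
  then have "real (card B) = real (card \<Omega>)"
    unfolding sum_fn_inner_indicator[OF \<Omega> B(2), symmetric] by simp
  moreover obtain ev where "\<And>b. b \<in> B \<Longrightarrow> b \<in> dirichlet_eigenspace \<Omega> (ev b)"
    using bchoice[of B "\<lambda>b \<mu>. b \<in> dirichlet_eigenspace \<Omega> \<mu>"] eig by blast
  ultimately have "dirichlet_eigenbasis \<Omega> B ev"
    unfolding dirichlet_eigenbasis_def using B complete by simp
  then show ?thesis by (rule that)
qed

lemma fn_inner_minus_dirichlet_laplacian_eigenfunction:
  assumes "finite \<Omega>" "f \<in> functions_on \<Omega>" "u \<in> dirichlet_eigenspace \<Omega> \<mu>"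
  shows "fn_inner \<Omega> (\<lambda>x. - dirichlet_laplacian \<Omega> f x) u = \<mu> * fn_inner \<Omega> f u"
proof -
  have "fn_inner \<Omega> (\<lambda>x. - dirichlet_laplacian \<Omega> f x) u
      = fn_inner \<Omega> f (\<lambda>x. - dirichlet_laplacian \<Omega> u x)"
    using assms by (intro minus_dirichlet_laplacian_symmetric) (auto simp: dirichlet_eigenspace_def)
  also have "\<dots> = fn_inner \<Omega> (\<lambda>x. \<mu> * u x) f"
    using assms(3) by (auto simp: fn_inner_def dirichlet_eigenspace_def intro!: sum.cong)
  finally show ?thesis by (simp add: fn_inner_left fn_inner_commute[of \<Omega> u f])
qed

lemma sum_fun_apply: "(\<Sum>a\<in>A. g a) x = (\<Sum>a\<in>A. g a x)"
  by (induction A rule: infinite_finite_induct) auto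

text \<open>By symmetry an eigenfunction for \<open>\<mu>\<close> is orthogonal to the basis
  elements with other eigenvalues, so the remaining ones span the eigenspace.\<close>

lemma dirichlet_multiplicity_eigenbasis:
  assumes \<Omega>: "finite \<Omega>" and B: "dirichlet_eigenbasis \<Omega> B ev"
  shows "dirichlet_multiplicity \<Omega> \<mu> = card {b\<in>B. ev b = \<mu>}"
  unfolding dirichlet_multiplicity_def
proof (rule function_space.dim_unique)
  let ?B = "{b\<in>B. ev b = \<mu>}"
  show "?B \<subseteq> dirichlet_eigenspace \<Omega> \<mu>" using B by (auto simp: dirichlet_eigenbasis_def)
  have fin: "finite ?B" and on: "orthonormal_fns \<Omega> ?B"
    using B by (auto simp: dirichlet_eigenbasis_def orthonormal_fns_def)
  show "function_space.independent ?B"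
  proof (rule function_space.independent_if_scalars_zero[OF fin])
    fix c b assume s: "(\<Sum>b\<in>?B. (\<lambda>x. c b * b x)) = 0" and b: "b \<in> ?B"
    have "(\<Sum>b\<in>?B. c b * b x) = 0" for x
      using fun_cong[OF s, of x] by (simp only: sum_fun_apply zero_fun_apply)
    then show "c b = 0"
      using orthonormal_coefficient_zero[OF fin on b, of c] by blast
  qed
  show "dirichlet_eigenspace \<Omega> \<mu> \<subseteq> function_space.span ?B"
  proof
    fix f assume f: "f \<in> dirichlet_eigenspace \<Omega> \<mu>"
    then have fS: "f \<in> functions_on \<Omega>" by (simp add: dirichlet_eigenspace_def)
    have zero: "fn_inner \<Omega> f b = 0" if b: "b \<in> B" "ev b \<noteq> \<mu>" for b
    proof -
      have "ev b * fn_inner \<Omega> f b = fn_inner \<Omega> (\<lambda>x. - dirichlet_laplacian \<Omega> f x) b"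
        using fn_inner_minus_dirichlet_laplacian_eigenfunction[OF \<Omega> fS, of b "ev b"] B b
        by (simp add: dirichlet_eigenbasis_def)
      also have "\<dots> = fn_inner \<Omega> (\<lambda>x. \<mu> * f x) b"
        using f by (auto simp: fn_inner_def dirichlet_eigenspace_def intro!: sum.cong)
      finally show ?thesis using b(2) by (simp add: fn_inner_left)
    qed
    have "f x = (\<Sum>b\<in>?B. (\<lambda>x. fn_inner \<Omega> f b * b x)) x" for x
    proof -
      have "f x = (\<Sum>b\<in>B. fn_inner \<Omega> f b * b x)" using B fS by (simp add: dirichlet_eigenbasis_def)
      also have "\<dots> = (\<Sum>b\<in>?B. fn_inner \<Omega> f b * b x)"
        using zero B by (intro sum.mono_neutral_right) (auto simp: dirichlet_eigenbasis_def)
      also have "\<dots> = (\<Sum>b\<in>?B. (\<lambda>x. fn_inner \<Omega> f b * b x)) x"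
        by (simp only: sum_fun_apply)
      finally show ?thesis .
    qed
    then have "f = (\<Sum>b\<in>?B. (\<lambda>x. fn_inner \<Omega> f b * b x))" by (rule ext)
    also have "\<dots> \<in> function_space.span ?B"
      by (intro function_space.span_sum function_space.span_scale function_space.span_base)
    finally show "f \<in> function_space.span ?B" .
  qed
qed simp

section \<open>The eigenvalue list as an enumeration of an eigenbasis\<close>

lemma count_concat_replicate:
  "distinct xs \<Longrightarrow> count (mset (concat (map (\<lambda>x. replicate (c x) x) xs))) y
    = (if y \<in> set xs then c y else 0)"
  by (induction xs) auto

lemma sorted_concat_replicate:
  "sorted xs \<Longrightarrow> sorted (concat (map (\<lambda>x. replicate (c x) x) xs))"
  by (induction xs) (auto simp: sorted_append)

text \<open>Links the list defined through dimensions of eigenspaces to an eigenbasis sorted by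
  \<open>ev\<close>: both lists are sorted, and every value occurs equally often in them.\<close>

lemma dirichlet_spectrum_eigenbasis:
  assumes \<Omega>: "finite \<Omega>" and B: "dirichlet_eigenbasis \<Omega> B ev"
  obtains us where "distinct us" "set us = B" "dirichlet_spectrum \<Omega> = map ev us"
proof -
  have fB: "finite B" using B by (simp add: dirichlet_eigenbasis_def)
  then obtain bs where bs: "set bs = B" "distinct bs" using finite_distinct_list by blast
  define us where "us = sort_key ev bs"
  let ?E = "{\<mu>. is_dirichlet_eigenvalue \<Omega> \<mu>}"
  note mult = dirichlet_multiplicity_eigenbasis[OF \<Omega> B]
  have notE: "card {b\<in>B. ev b = \<mu>} = 0" if "\<mu> \<notin> ?E" for \<mu>
  proof -
    have "{b\<in>B. ev b = \<mu>} = {}"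
    proof (rule ccontr)
      assume "{b\<in>B. ev b = \<mu>} \<noteq> {}"
      then obtain b where b: "b \<in> B" "ev b = \<mu>" by blast
      have "fn_inner \<Omega> b b = 1" using b B by (auto simp: dirichlet_eigenbasis_def orthonormal_fns_def)
      then have "b \<noteq> (\<lambda>x. 0)" by (auto simp: fn_inner_def)
      then show False using b B that by (auto simp: is_dirichlet_eigenvalue_def dirichlet_eigenbasis_def)
    qed
    then show ?thesis by (simp only: card.empty)
  qed
  have "mset (dirichlet_spectrum \<Omega>) = mset (map ev us)"
  proof (rule multiset_eqI)
    fix \<mu>
    have "count (mset (dirichlet_spectrum \<Omega>)) \<mu> = (if \<mu> \<in> ?E then card {b\<in>B. ev b = \<mu>} else 0)"
      unfolding dirichlet_spectrum_def
      by (subst count_concat_replicate) (simp_all add: finite_dirichlet_eigenvalues[OF \<Omega>] mult)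
    also have "\<dots> = card {b\<in>B. ev b = \<mu>}" using notE by auto
    also have "\<dots> = count (image_mset ev (mset_set B)) \<mu>"
      using fB by (simp add: count_image_mset vimage_def Int_def conj_commute)
    also have "mset_set B = mset us"
      using bs by (simp add: us_def mset_set_set[symmetric])
    finally show "count (mset (dirichlet_spectrum \<Omega>)) \<mu> = count (mset (map ev us)) \<mu>" by simp
  qed
  moreover have "sorted (dirichlet_spectrum \<Omega>)"
    unfolding dirichlet_spectrum_def by (intro sorted_concat_replicate sorted_sorted_list_of_set)
  moreover have "sorted (map ev us)" by (simp add: us_def)
  ultimately have "dirichlet_spectrum \<Omega> = map ev us"
    by (metis properties_for_sort)
  then show ?thesis using that[of us] bs by (simp add: us_def)
qed

lemma length_dirichlet_spectrum:
  assumes \<Omega>: "finite \<Omega>"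
  shows "length (dirichlet_spectrum \<Omega>) = card \<Omega>"
proof -
  obtain B ev where B: "dirichlet_eigenbasis \<Omega> B ev" using exists_dirichlet_eigenbasis[OF \<Omega>] .
  obtain us where us: "distinct us" "set us = B" "dirichlet_spectrum \<Omega> = map ev us"
    using dirichlet_spectrum_eigenbasis[OF \<Omega> B] .
  then show ?thesis using B distinct_card[of us] by (simp add: dirichlet_eigenbasis_def)
qed

lemma dirichlet_eigenvalue_mono:
  assumes \<Omega>: "finite \<Omega>" and "i \<le> j" "j < card \<Omega>"
  shows "dirichlet_eigenvalue \<Omega> (Suc i) \<le> dirichlet_eigenvalue \<Omega> (Suc j)"
proof -
  have "sorted (dirichlet_spectrum \<Omega>)"
    unfolding dirichlet_spectrum_def by (intro sorted_concat_replicate sorted_sorted_list_of_set)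
  then show ?thesis
    using assms length_dirichlet_spectrum[OF \<Omega>] by (simp add: dirichlet_eigenvalue_def sorted_nth_mono)
qed

lemma exists_orthonormal_dirichlet_eigenfunctions:
  fixes \<Omega> :: "(int ^ 'n) set"
  assumes \<Omega>: "finite \<Omega>"
  shows "\<exists>u. (\<forall>i<card \<Omega>. u i \<in> dirichlet_eigenspace \<Omega> (dirichlet_eigenvalue \<Omega> (Suc i))
      \<and> fn_inner \<Omega> (u i) (u i) = 1)
    \<and> (\<forall>f g. fn_inner \<Omega> f g = (\<Sum>i<card \<Omega>. fn_inner \<Omega> f (u i) * fn_inner \<Omega> g (u i)))"
proof -
  obtain B ev where B: "dirichlet_eigenbasis \<Omega> B ev" using exists_dirichlet_eigenbasis[OF \<Omega>] .
  obtain us where us: "distinct us" "set us = B" "dirichlet_spectrum \<Omega> = map ev us"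
    using dirichlet_spectrum_eigenbasis[OF \<Omega> B] .
  have len: "length us = card \<Omega>"
    using length_dirichlet_spectrum[OF \<Omega>] us(3) by simp
  have bij: "bij_betw ((!) us) {..<card \<Omega>} B"
    using bij_betw_nth[OF us(1), of "{..<card \<Omega>}" B] len us by simp
  have "us ! i \<in> dirichlet_eigenspace \<Omega> (dirichlet_eigenvalue \<Omega> (Suc i))
      \<and> fn_inner \<Omega> (us ! i) (us ! i) = 1" if i: "i < card \<Omega>" for i
  proof -
    have "us ! i \<in> B" using i us(2) len nth_mem by metis
    moreover have "dirichlet_eigenvalue \<Omega> (Suc i) = ev (us ! i)"
      using i us(3) len by (simp add: dirichlet_eigenvalue_def)
    ultimately show ?thesis using B by (simp add: dirichlet_eigenbasis_def orthonormal_fns_def)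
  qed
  moreover have "fn_inner \<Omega> f g = (\<Sum>i<card \<Omega>. fn_inner \<Omega> f (us ! i) * fn_inner \<Omega> g (us ! i))" for f g
  proof -
    \<comment> \<open>The expansion in \<open>B\<close> needs support in \<open>\<Omega>\<close>,
      while inner products ignore values outside. The zero extension thus gives Parseval for all
      functions, including central differences, which may be nonzero outside
      \<open>\<Omega>\<close>.\<close>
    let ?f = "zero_extension \<Omega> f"
    have z: "fn_inner \<Omega> ?f h = fn_inner \<Omega> f h" for h
      by (simp add: fn_inner_def zero_extension_def)
    have "?f = (\<lambda>x. \<Sum>b\<in>B. fn_inner \<Omega> ?f b * b x)"
      using B by (simp add: dirichlet_eigenbasis_def functions_on_def zero_extension_def fun_eq_iff)
    then have "fn_inner \<Omega> ?f g = fn_inner \<Omega> (\<lambda>x. \<Sum>b\<in>B. fn_inner \<Omega> ?f b * b x) g"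
      by (rule arg_cong)
    also have "\<dots> = (\<Sum>b\<in>B. fn_inner \<Omega> f b * fn_inner \<Omega> g b)"
      by (simp add: fn_inner_left z fn_inner_commute[of \<Omega> _ g])
    also have "\<dots> = (\<Sum>i<card \<Omega>. fn_inner \<Omega> f (us ! i) * fn_inner \<Omega> g (us ! i))"
      using sum.reindex_bij_betw[OF bij, symmetric] .
    finally show ?thesis by (simp add: z)
  qed
  ultimately show ?thesis by blast
qed

section \<open>Yang's inequality\<close>

text \<open>The difference of the two sides is a double sum over \<open>i < k\<close> and \<open>j < N\<close> whose terms are
  antisymmetric in \<open>i, j\<close> for \<open>j < k\<close> and nonpositive for \<open>j \<ge> k\<close>.\<close>

lemma harrell_stubbe_sum:
  fixes l :: "nat \<Rightarrow> real" and a :: "nat \<Rightarrow> nat \<Rightarrow> real"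
  assumes k: "k < N" and sym: "\<And>i j. i < k \<Longrightarrow> j < k \<Longrightarrow> a i j = a j i"
    and mono: "\<And>i j. i \<le> j \<Longrightarrow> j < N \<Longrightarrow> l i \<le> l j"
  shows "(\<Sum>i<k. (l k - l i)^2 * (\<Sum>j<N. (l j - l i) * (a i j)^2))
    \<le> (\<Sum>i<k. (l k - l i) * (\<Sum>j<N. (l j - l i)^2 * (a i j)^2))"
proof -
  \<comment> \<open>The factor \<open>l k - l j\<close> is \<open>(l k - l i) - (l j - l i)\<close>,
    left over once the common factors of the two sides are taken out.\<close>
  define t where "t i j = (l k - l i) * (l j - l i) * (l k - l j) * (a i j)^2" for i j
  have "(\<Sum>i<k. \<Sum>j<k. t i j) = (\<Sum>i<k. \<Sum>j<k. t j i)" by (rule sum.swap)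
  also have "\<dots> = (\<Sum>i<k. \<Sum>j<k. - t i j)"
    using sym by (intro sum.cong refl) (simp add: t_def algebra_simps)
  finally have 1: "(\<Sum>i<k. \<Sum>j<k. t i j) = 0" by (simp add: sum_negf)
  have 2: "t i j \<le> 0" if "i < k" "k \<le> j" "j < N" for i j
  proof -
    have "(l k - l i) * (l j - l i) \<ge> 0" "l k - l j \<le> 0"
      using mono[of i k] mono[of i j] mono[of k j] that k by auto
    then show ?thesis unfolding t_def by (simp add: mult_nonneg_nonpos mult_nonpos_nonneg)
  qed
  have "(\<Sum>j<N. t i j) = (\<Sum>j<k. t i j) + (\<Sum>j=k..<N. t i j)" for i
    using k sum.atLeastLessThan_concat[of 0 k N "t i"] by (simp add: lessThan_atLeast0)
  then have "(\<Sum>i<k. \<Sum>j<N. t i j) = (\<Sum>i<k. \<Sum>j=k..<N. t i j)"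
    using 1 by (simp add: sum.distrib)
  also have "\<dots> \<le> 0" using 2 by (intro sum_nonpos) auto
  also have "(\<Sum>i<k. \<Sum>j<N. t i j) = (\<Sum>i<k. (l k - l i)^2 * (\<Sum>j<N. (l j - l i) * (a i j)^2))
      - (\<Sum>i<k. (l k - l i) * (\<Sum>j<N. (l j - l i)^2 * (a i j)^2))"
    unfolding sum_subtractf[symmetric] sum_distrib_left
    by (intro sum.cong refl) (simp add: t_def algebra_simps power2_eq_square)
  finally show ?thesis by simp
qed

section \<open>Overlaps, central differences and commutators with a coordinate\<close>

definition directional_overlap :: "(int ^ 'n) set \<Rightarrow> 'n \<Rightarrow> (int ^ 'n \<Rightarrow> real) \<Rightarrow> real" where
  "directional_overlap \<Omega> \<alpha> f = (\<Sum>x\<in>\<Omega>. f x * f (x + axis \<alpha> 1))"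

text \<open>Dividing by the degree 2n rather than by 2 makes this exactly minus the commutator with
  the coordinate.\<close>

definition central_difference :: "'n \<Rightarrow> (int ^ 'n \<Rightarrow> real) \<Rightarrow> int ^ 'n \<Rightarrow> real" where
  "central_difference \<alpha> f = (\<lambda>x. (f (x + axis \<alpha> 1) - f (x - axis \<alpha> 1)) / (2 * real CARD('n)))"

lemma sum_shift_back:
  assumes "finite \<Omega>" "f \<in> functions_on \<Omega>"
  shows "(\<Sum>x\<in>\<Omega>. f x * f (x - axis \<alpha> 1)) = directional_overlap \<Omega> \<alpha> f"
  using sum_shift[OF assms assms(2), of "axis \<alpha> 1"] by (simp add: directional_overlap_def mult.commute)

text \<open>Pair the eigenvalue equation with \<open>u\<close>: forward and backward shifts in one
  direction give the same overlap. The factor 1 minus eigenvalue in Yang's inequality originates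
  here.\<close>

lemma sum_directional_overlap:
  fixes \<Omega> :: "(int ^ 'n) set"
  assumes \<Omega>: "finite \<Omega>" and u: "u \<in> dirichlet_eigenspace \<Omega> \<mu>" and u1: "fn_inner \<Omega> u u = 1"
  shows "(\<Sum>\<alpha>\<in>UNIV. directional_overlap \<Omega> \<alpha> u) = real CARD('n) * (1 - \<mu>)"
proof -
  define c where "c = 1 / (2 * real CARD('n))"
  have uS: "u \<in> functions_on \<Omega>" using u by (simp add: dirichlet_eigenspace_def)
  have "\<mu> = fn_inner \<Omega> (\<lambda>x. - dirichlet_laplacian \<Omega> u x) u"
    using fn_inner_minus_dirichlet_laplacian_eigenfunction[OF \<Omega> uS u] u1 by simp
  also have "\<dots> = (\<Sum>x\<in>\<Omega>. (u x - c * (\<Sum>\<alpha>\<in>UNIV. u (x + axis \<alpha> 1) + u (x - axis \<alpha> 1))) * u x)"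
    unfolding fn_inner_def c_def using minus_dirichlet_laplacian_eq[OF uS] by simp
  also have "\<dots> = fn_inner \<Omega> u u
      - c * (\<Sum>x\<in>\<Omega>. \<Sum>\<alpha>\<in>UNIV. u x * u (x + axis \<alpha> 1) + u x * u (x - axis \<alpha> 1))"
    by (simp add: left_diff_distrib sum_subtractf fn_inner_def sum_distrib_left sum_distrib_right
        algebra_simps)
  also have "(\<Sum>x\<in>\<Omega>. \<Sum>\<alpha>\<in>UNIV. u x * u (x + axis \<alpha> 1) + u x * u (x - axis \<alpha> 1))
      = (\<Sum>\<alpha>\<in>UNIV. \<Sum>x\<in>\<Omega>. u x * u (x + axis \<alpha> 1) + u x * u (x - axis \<alpha> 1))"
    by (rule sum.swap)
  also have "\<dots> = (\<Sum>\<alpha>\<in>UNIV. 2 * directional_overlap \<Omega> \<alpha> u)"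
    by (simp add: sum.distrib sum_shift_back[OF \<Omega> uS]) (simp add: directional_overlap_def sum_distrib_left)
  finally show ?thesis by (simp add: u1 c_def sum_distrib_left[symmetric] field_simps)
qed

text \<open>A translate of \<open>\<Omega>\<close> can miss part of the support of \<open>f\<close>,
  hence an inequality.\<close>

lemma sum_shift_square_le:
  fixes f :: "int ^ 'n \<Rightarrow> real"
  assumes "finite \<Omega>" "f \<in> functions_on \<Omega>"
  shows "(\<Sum>x\<in>\<Omega>. (f (x + e))^2) \<le> fn_inner \<Omega> f f"
proof -
  have "(\<Sum>x\<in>\<Omega>. (f (x + e))^2) = (\<Sum>y\<in>(\<lambda>x. x + e) ` \<Omega>. (f y)^2)"
    by (subst sum.reindex) (auto simp: inj_on_def)
  also have "\<dots> \<le> (\<Sum>y\<in>(\<lambda>x. x + e) ` \<Omega> \<union> \<Omega>. (f y)^2)"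
    using assms by (intro sum_mono2) auto
  also have "\<dots> = (\<Sum>y\<in>\<Omega>. (f y)^2)"
    using assms by (intro sum.mono_neutral_right) (auto simp: functions_on_def)
  finally show ?thesis by (simp add: fn_inner_def power2_eq_square)
qed

lemma fn_inner_central_difference_le:
  fixes \<Omega> :: "(int ^ 'n) set"
  assumes \<Omega>: "finite \<Omega>" and u: "u \<in> functions_on \<Omega>" and u1: "fn_inner \<Omega> u u = 1"
  shows "fn_inner \<Omega> (central_difference \<alpha> u) (central_difference \<alpha> u)
    \<le> 2 / (real CARD('n))^2 * (1 - directional_overlap \<Omega> \<alpha> u)"
proof -
  let ?e = "axis \<alpha> (1::int)" and ?n = "real CARD('n)"
  have "(\<Sum>x\<in>\<Omega>. (u (x + ?e) - u (x - ?e))^2)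
      \<le> (\<Sum>x\<in>\<Omega>. 2 * ((u (x + ?e))^2 + (u (x + (- ?e)))^2 + 2 * (u x * u x)
          - 2 * (u x * u (x + ?e)) - 2 * (u x * u (x - ?e))))"
  proof (rule sum_mono)
    fix x
    \<comment> \<open>The parallelogram law for \<open>p - r\<close> and \<open>q - r\<close>; the
      squared second difference is then discarded.\<close>
    have "(p - q)^2 + (p + q - 2 * r)^2 = 2 * (p^2 + q^2 + 2 * (r * r) - 2 * (r * p) - 2 * (r * q))"
      for p q r :: real by (simp add: power2_eq_square algebra_simps)
    from this[of "u (x + ?e)" "u (x - ?e)" "u x"] zero_le_power2[of "u (x + ?e) + u (x - ?e) - 2 * u x"]
    show "(u (x + ?e) - u (x - ?e))^2 \<le> 2 * ((u (x + ?e))^2 + (u (x + (- ?e)))^2 + 2 * (u x * u x)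
          - 2 * (u x * u (x + ?e)) - 2 * (u x * u (x - ?e)))" by (simp only: diff_conv_add_uminus)
  qed
  also have "\<dots> = 2 * ((\<Sum>x\<in>\<Omega>. (u (x + ?e))^2) + (\<Sum>x\<in>\<Omega>. (u (x + (- ?e)))^2) + 2 * fn_inner \<Omega> u u
      - 4 * directional_overlap \<Omega> \<alpha> u)"
    unfolding sum_distrib_left[symmetric]
    by (simp only: sum_subtractf sum.distrib sum_distrib_left[symmetric] sum_shift_back[OF \<Omega> u])
      (simp add: directional_overlap_def fn_inner_def)
  also have "\<dots> \<le> 8 * (1 - directional_overlap \<Omega> \<alpha> u)"
    using sum_shift_square_le[OF \<Omega> u, of ?e] sum_shift_square_le[OF \<Omega> u, of "- ?e"] u1 by simp
  finally have "(\<Sum>x\<in>\<Omega>. (u (x + ?e) - u (x - ?e))^2) / (2 * ?n)^2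
      \<le> 8 * (1 - directional_overlap \<Omega> \<alpha> u) / (2 * ?n)^2"
    by (rule divide_right_mono) simp
  moreover have "fn_inner \<Omega> (central_difference \<alpha> u) (central_difference \<alpha> u)
      = (\<Sum>x\<in>\<Omega>. (u (x + ?e) - u (x - ?e))^2) / (2 * ?n)^2"
    by (simp add: fn_inner_def central_difference_def sum_divide_distrib power2_eq_square)
  moreover have "8 * (1 - directional_overlap \<Omega> \<alpha> u) / (2 * ?n)^2
      = 2 / ?n^2 * (1 - directional_overlap \<Omega> \<alpha> u)"
    by (simp add: power_mult_distrib divide_simps)
  ultimately show ?thesis by simp
qed

lemma dirichlet_laplacian_coordinate_commutator:
  fixes \<Omega> :: "(int ^ 'n) set"
  assumes u: "u \<in> functions_on \<Omega>" and x: "x \<in> \<Omega>"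
  shows "- dirichlet_laplacian \<Omega> (\<lambda>x. real_of_int (x $ \<alpha>) * u x) x
    = - (real_of_int (x $ \<alpha>) * dirichlet_laplacian \<Omega> u x) - central_difference \<alpha> u x"
proof -
  let ?X = "\<lambda>x. real_of_int (x $ \<alpha>) * u x" and ?c = "1 / (2 * real CARD('n))"
  have "?X \<in> functions_on \<Omega>" using u by (auto simp: functions_on_def)
  then have "- dirichlet_laplacian \<Omega> ?X x
      = ?X x - ?c * (\<Sum>i\<in>UNIV. ?X (x + axis i 1) + ?X (x - axis i 1))"
    using x by (rule minus_dirichlet_laplacian_eq)
  \<comment> \<open>A step in direction \<open>i\<close> changes coordinate \<open>\<alpha>\<close>
    only if \<open>i = \<alpha>\<close>, and then by one.\<close>
  also have "(\<Sum>i\<in>UNIV. ?X (x + axis i 1) + ?X (x - axis i 1))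
      = (\<Sum>i\<in>UNIV. real_of_int (x $ \<alpha>) * (u (x + axis i 1) + u (x - axis i 1))
          + (if i = \<alpha> then u (x + axis i 1) - u (x - axis i 1) else 0))"
    by (intro sum.cong refl) (auto simp: axis_def algebra_simps)
  also have "\<dots> = real_of_int (x $ \<alpha>) * (\<Sum>i\<in>UNIV. u (x + axis i 1) + u (x - axis i 1))
      + (u (x + axis \<alpha> 1) - u (x - axis \<alpha> 1))"
    by (simp add: sum.distrib[of _ "\<lambda>i. if i = \<alpha> then _ i else 0"] sum_distrib_left)
  finally have "- dirichlet_laplacian \<Omega> ?X x = real_of_int (x $ \<alpha>) * (u x
      - ?c * (\<Sum>i\<in>UNIV. u (x + axis i 1) + u (x - axis i 1))) - central_difference \<alpha> u x"
    by (simp add: central_difference_def algebra_simps diff_divide_distrib add_divide_distrib)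
  also have "u x - ?c * (\<Sum>i\<in>UNIV. u (x + axis i 1) + u (x - axis i 1)) = - dirichlet_laplacian \<Omega> u x"
    using minus_dirichlet_laplacian_eq[OF u x] by simp
  finally show ?thesis by simp
qed

lemma fn_inner_central_difference_eigenfunction:
  assumes \<Omega>: "finite \<Omega>" and u: "u \<in> dirichlet_eigenspace \<Omega> \<mu>" and v: "v \<in> dirichlet_eigenspace \<Omega> \<nu>"
  shows "fn_inner \<Omega> (central_difference \<alpha> u) v
    = (\<mu> - \<nu>) * fn_inner \<Omega> (\<lambda>x. real_of_int (x $ \<alpha>) * u x) v"
proof -
  let ?X = "\<lambda>x. real_of_int (x $ \<alpha>) * u x"
  have uS: "u \<in> functions_on \<Omega>" using u by (simp add: dirichlet_eigenspace_def)
  then have XS: "?X \<in> functions_on \<Omega>" by (auto simp: functions_on_def)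
  have "fn_inner \<Omega> (central_difference \<alpha> u) v
      = fn_inner \<Omega> (\<lambda>x. \<mu> * ?X x - (- dirichlet_laplacian \<Omega> ?X x)) v"
    unfolding fn_inner_def
  proof (intro sum.cong refl)
    fix x assume x: "x \<in> \<Omega>"
    have "- dirichlet_laplacian \<Omega> u x = \<mu> * u x" using u x by (simp add: dirichlet_eigenspace_def)
    then have "- (real_of_int (x $ \<alpha>) * dirichlet_laplacian \<Omega> u x) = \<mu> * ?X x"
      by (metis mult.left_commute mult_minus_right)
    then show "central_difference \<alpha> u x * v x = (\<mu> * ?X x - (- dirichlet_laplacian \<Omega> ?X x)) * v x"
      unfolding dirichlet_laplacian_coordinate_commutator[OF uS x] by simp
  qed
  then show ?thesis
    by (simp only: fn_inner_left fn_inner_minus_dirichlet_laplacian_eigenfunction[OF \<Omega> XS v])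
      (simp add: algebra_simps)
qed

text \<open>A shift turns both halves into sums over products of \<open>u\<close> at neighbouring
  points. Their coordinate weights differ by one, so the coordinate cancels and the overlap
  remains.\<close>

lemma fn_inner_central_difference_coordinate:
  fixes \<Omega> :: "(int ^ 'n) set"
  assumes \<Omega>: "finite \<Omega>" and u: "u \<in> functions_on \<Omega>"
  shows "fn_inner \<Omega> (central_difference \<alpha> u) (\<lambda>x. real_of_int (x $ \<alpha>) * u x)
    = - directional_overlap \<Omega> \<alpha> u / (2 * real CARD('n))"
proof -
  let ?X = "\<lambda>x. real_of_int (x $ \<alpha>) * u x" and ?e = "axis \<alpha> (1::int)"
  have XS: "?X \<in> functions_on \<Omega>" using u by (auto simp: functions_on_def)
  have "(\<Sum>x\<in>\<Omega>. (u (x + ?e) - u (x - ?e)) * ?X x)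
      = (\<Sum>x\<in>\<Omega>. u (x + ?e) * ?X x) - (\<Sum>x\<in>\<Omega>. ?X x * u (x - ?e))"
    unfolding sum_subtractf[symmetric] by (intro sum.cong refl) (simp add: algebra_simps)
  also have "(\<Sum>x\<in>\<Omega>. ?X x * u (x - ?e)) = (\<Sum>x\<in>\<Omega>. ?X (x + ?e) * u x)"
    by (rule sum_shift[OF \<Omega> XS u])
  also have "(\<Sum>x\<in>\<Omega>. u (x + ?e) * ?X x) - \<dots> = - directional_overlap \<Omega> \<alpha> u"
    unfolding directional_overlap_def sum_subtractf[symmetric] sum_negf[symmetric]
    by (intro sum.cong refl) (simp add: algebra_simps)
  finally show ?thesis
    by (simp add: fn_inner_def central_difference_def sum_divide_distrib[symmetric])
qed

text \<open>Indices start at 0: \<open>l k\<close> is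
  \<open>\<lambda>\<^sub>k\<^sub>+\<^sub>1\<close>, and the sums run over the first \<open>k\<close>
  eigenvalues.\<close>

theorem dirichlet_yang_inequality:
  fixes \<Omega> :: "(int ^ 'n) set"
  assumes \<Omega>: "finite \<Omega>" and k: "k < card \<Omega>"
  defines "l \<equiv> \<lambda>i. dirichlet_eigenvalue \<Omega> (Suc i)"
  shows "(\<Sum>i<k. (l k - l i)^2 * (1 - l i)) \<le> 4 / real CARD('n) * (\<Sum>i<k. (l k - l i) * l i)"
proof -
  let ?N = "card \<Omega>" and ?n = "real CARD('n)"
  obtain u where "\<forall>i<?N. u i \<in> dirichlet_eigenspace \<Omega> (l i) \<and> fn_inner \<Omega> (u i) (u i) = 1"
    and parseval: "\<And>f g. fn_inner \<Omega> f g = (\<Sum>i<?N. fn_inner \<Omega> f (u i) * fn_inner \<Omega> g (u i))"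
    using exists_orthonormal_dirichlet_eigenfunctions[OF \<Omega>] unfolding l_def by blast
  then have u: "u i \<in> dirichlet_eigenspace \<Omega> (l i)" and u1: "fn_inner \<Omega> (u i) (u i) = 1"
    if "i < ?N" for i using that by blast+
  have mono: "l i \<le> l j" if "i \<le> j" "j < ?N" for i j
    unfolding l_def using dirichlet_eigenvalue_mono[OF \<Omega> that] .
  have uS: "u i \<in> functions_on \<Omega>" if "i < ?N" for i using u[OF that] by (simp add: dirichlet_eigenspace_def)
  define W where "W \<alpha> i = directional_overlap \<Omega> \<alpha> (u i)" for \<alpha> i
  have W: "(\<Sum>\<alpha>\<in>UNIV. W \<alpha> i) = ?n * (1 - l i)" if "i < ?N" for i
    unfolding W_def using sum_directional_overlap[OF \<Omega> u[OF that] u1[OF that]] .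
  \<comment> \<open>The overlaps turn into eigenvalues only after summation over
    \<open>\<alpha>\<close>, where \<open>W\<close> adds up to \<open>?n * (1 - l i)\<close> and
    \<open>1 - W\<close> to \<open>?n * l i\<close>.\<close>
  have dir: "(\<Sum>i<k. (l k - l i)^2 * (W \<alpha> i / (2 * ?n)))
      \<le> (\<Sum>i<k. (l k - l i) * (2 / ?n^2 * (1 - W \<alpha> i)))" for \<alpha>
  proof -
    define X where "X i = (\<lambda>x. real_of_int (x $ \<alpha>) * u i x)" for i
    define a where "a i j = fn_inner \<Omega> (X i) (u j)" for i j
    have com: "fn_inner \<Omega> (central_difference \<alpha> (u i)) (u j) = (l i - l j) * a i j"
      if "i < ?N" "j < ?N" for i j
      unfolding a_def X_def using fn_inner_central_difference_eigenfunction[OF \<Omega> u u] that by simp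
    \<comment> \<open>Two moments of \<open>(a i j)^2\<close> against the gaps
      \<open>l j - l i\<close>: the first comes from pairing the central difference with
      \<open>X i\<close> and is exact, the second is its squared norm and is bounded.\<close>
    have 1: "(\<Sum>j<?N. (l j - l i) * (a i j)^2) = W \<alpha> i / (2 * ?n)" if i: "i < ?N" for i
    proof -
      have "- W \<alpha> i / (2 * ?n) = fn_inner \<Omega> (central_difference \<alpha> (u i)) (X i)"
        unfolding W_def X_def fn_inner_central_difference_coordinate[OF \<Omega> uS[OF i]] ..
      also have "\<dots> = (\<Sum>j<?N. (l i - l j) * a i j * a i j)"
        unfolding parseval[of "central_difference \<alpha> (u i)" "X i"]
        by (intro sum.cong refl) (simp add: com[OF i] a_def)
      also have "\<dots> = - (\<Sum>j<?N. (l j - l i) * (a i j)^2)"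
        unfolding sum_negf[symmetric] by (intro sum.cong refl) (simp add: power2_eq_square algebra_simps)
      finally show ?thesis by simp
    qed
    have 2: "(\<Sum>j<?N. (l j - l i)^2 * (a i j)^2) \<le> 2 / ?n^2 * (1 - W \<alpha> i)" if i: "i < ?N" for i
    proof -
      have "(\<Sum>j<?N. (l j - l i)^2 * (a i j)^2)
          = fn_inner \<Omega> (central_difference \<alpha> (u i)) (central_difference \<alpha> (u i))"
        unfolding parseval[of "central_difference \<alpha> (u i)" "central_difference \<alpha> (u i)"]
        by (intro sum.cong refl) (simp add: com[OF i] power2_eq_square algebra_simps)
      then show ?thesis
        unfolding W_def using fn_inner_central_difference_le[OF \<Omega> uS[OF i] u1[OF i]] by simp
    qed
    have sym: "a i j = a j i" for i j
      by (simp add: a_def X_def fn_inner_def mult_ac)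
    have "(\<Sum>i<k. (l k - l i)^2 * (W \<alpha> i / (2 * ?n)))
        = (\<Sum>i<k. (l k - l i)^2 * (\<Sum>j<?N. (l j - l i) * (a i j)^2))"
      using 1 k by (intro sum.cong refl) simp
    also have "\<dots> \<le> (\<Sum>i<k. (l k - l i) * (\<Sum>j<?N. (l j - l i)^2 * (a i j)^2))"
      using k sym mono by (rule harrell_stubbe_sum)
    also have "\<dots> \<le> (\<Sum>i<k. (l k - l i) * (2 / ?n^2 * (1 - W \<alpha> i)))"
    proof (intro sum_mono mult_left_mono)
      fix i assume "i \<in> {..<k}"
      then show "(\<Sum>j<?N. (l j - l i)^2 * (a i j)^2) \<le> 2 / ?n^2 * (1 - W \<alpha> i)" "0 \<le> l k - l i"
        using 2 k mono[of i k] by auto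
    qed
    finally show ?thesis .
  qed
  have "(\<Sum>i<k. (l k - l i)^2 * (1 - l i)) / 2
      = (\<Sum>i<k. (l k - l i)^2 * ((\<Sum>\<alpha>\<in>UNIV. W \<alpha> i) / (2 * ?n)))"
    using W k by (simp add: sum_divide_distrib)
  also have "\<dots> = (\<Sum>\<alpha>\<in>UNIV. \<Sum>i<k. (l k - l i)^2 * (W \<alpha> i / (2 * ?n)))"
    unfolding sum_divide_distrib sum_distrib_left by (rule sum.swap)
  also have "\<dots> \<le> (\<Sum>\<alpha>\<in>UNIV. \<Sum>i<k. (l k - l i) * (2 / ?n^2 * (1 - W \<alpha> i)))"
    by (rule sum_mono) (rule dir)
  also have "\<dots> = (\<Sum>i<k. (l k - l i) * (2 / ?n^2 * (\<Sum>\<alpha>\<in>UNIV. 1 - W \<alpha> i)))"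
    unfolding sum_distrib_left by (rule sum.swap)
  also have "\<dots> = (\<Sum>i<k. (l k - l i) * (2 / ?n * l i))"
  proof (intro sum.cong refl)
    fix i assume "i \<in> {..<k}"
    then have "(\<Sum>\<alpha>\<in>UNIV. 1 - W \<alpha> i) = ?n * l i"
      using W[of i] k by (simp add: sum_subtractf algebra_simps)
    then show "(l k - l i) * (2 / ?n^2 * (\<Sum>\<alpha>\<in>UNIV. 1 - W \<alpha> i)) = (l k - l i) * (2 / ?n * l i)"
      by (simp add: power2_eq_square)
  qed
  also have "\<dots> = 2 / ?n * (\<Sum>i<k. (l k - l i) * l i)"
    by (simp add: sum_distrib_left mult_ac)
  finally show ?thesis by simp
qed

section \<open>The Cheng--Yang recursion\<close>

text \<open>Multiplied by \<open>(1 - y) powr p\<close>, the polynomial equals 1 at 0 and is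
  nonincreasing: in the second factor of its derivative everything cancels except a nonpositive
  multiple of \<open>x^3\<close>.\<close>

lemma inverse_powr_ge_taylor3:
  fixes p y :: real
  assumes "0 \<le> p" "0 \<le> y" "y < 1"
  shows "1 + p * y + p * (p + 1) / 2 * y^2 + p * (p + 1) * (p + 2) / 6 * y^3 \<le> (1 - y) powr (- p)"
proof -
  define P where "P y = 1 + p * y + p * (p + 1) / 2 * y^2 + p * (p + 1) * (p + 2) / 6 * y^3" for y
  define P' where "P' y = p + p * (p + 1) * y + p * (p + 1) * (p + 2) / 2 * y^2" for y
  have dP: "(P has_real_derivative P' x) (at x)" for x
    unfolding P_def P'_def by (auto intro!: derivative_eq_intros simp: field_simps power2_eq_square)
  have "(1 - y) powr p * P y \<le> (1 - 0) powr p * P 0"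
  proof (rule DERIV_nonpos_imp_nonincreasing[OF assms(2)])
    fix x assume x: "0 \<le> x" "x \<le> y"
    have "((\<lambda>y. (1 - y) powr p * P y) has_real_derivative
        (1 - x) powr (p - 1) * ((1 - x) * P' x - p * P x)) (at x)"
      using x assms
      by (auto intro!: derivative_eq_intros dP simp: powr_diff field_simps)
    moreover have "(1 - x) * P' x - p * P x = - (p * (p + 1) * (p + 2) * (p + 3) / 6 * x^3)"
      unfolding P_def P'_def by (simp add: field_simps power2_eq_square power3_eq_cube)
    moreover have "p * (p + 1) * (p + 2) * (p + 3) / 6 * x^3 \<ge> 0"
      using assms x by simp
    ultimately show "\<exists>d. ((\<lambda>y. (1 - y) powr p * P y) has_real_derivative d) (at x) \<and> d \<le> 0"
      by (metis mult_nonneg_nonpos neg_le_0_iff_le powr_ge_zero)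
  qed
  then have "(1 - y) powr p * P y \<le> 1" by (simp add: P_def)
  then show ?thesis
    using assms by (simp add: P_def powr_minus_divide field_simps)
qed

text \<open>The first factor on the right is chosen so that \<open>1 - y\<close> plus \<open>(1 + 2a) y\<close> times it is the cubic Taylor
  polynomial of \<open>(1 - y)\<^bsup>-2a\<^esup>\<close>.\<close>

lemma recursion_quadratic:
  fixes a y s \<Lambda> :: real
  assumes "0 \<le> a" "0 \<le> y" "y \<le> 1/2"
  shows "a * \<Lambda>^2 + 2 * a * \<Lambda> * s + ((1 + a) * y - 1) * s^2
    \<le> (1 + a * y + 2/3 * a * (1 + a) * y^2) * (s^2 - 2 * a * \<Lambda> * s + (a + 2 * a^2) * \<Lambda>^2)"
proof -
  \<comment> \<open>In these variables the difference of the two sides is a sum of squares whose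
    weights are nonnegative for \<open>y \<le> 1/2\<close>.\<close>
  define v where "v = s - a * \<Lambda>"
  define e where "e = (1 + a) * y"
  have "(1 + a * y + 2/3 * a * (1 + a) * y^2) * (s^2 - 2 * a * \<Lambda> * s + (a + 2 * a^2) * \<Lambda>^2)
      - (a * \<Lambda>^2 + 2 * a * \<Lambda> * s + ((1 + a) * y - 1) * s^2)
    = 2/3 * (a * e * \<Lambda> - 3/2 * v)^2 + (1/2 - y) * v^2 + 2/3 * a * e * y * v^2"
    unfolding v_def e_def by (simp add: field_simps power2_eq_square)
  also have "\<dots> \<ge> 0"
    using assms by (simp add: e_def)
  finally show ?thesis by linarith
qed

text \<open>The step from \<open>F\<^sub>k\<close> to \<open>F\<^sub>k\<^sub>+\<^sub>1\<close>:
  \<open>\<Lambda>\<close> and \<open>T\<close> stand for the means of the first \<open>k\<close>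
  values and of their squares, \<open>m\<close> for the next value, and the last hypothesis for
  Yang's inequality divided by \<open>k\<close>.\<close>

lemma yang_deficit_step:
  fixes a k \<Lambda> T m :: real
  assumes a: "0 \<le> a" and k: "1 \<le> k"
    and yang: "m^2 - 2 * (1 + a) * m * \<Lambda> + (1 + 2 * a) * T \<le> 0"
  shows "(1 + a) * ((k * \<Lambda> + m) / (k + 1))^2 - (k * T + m^2) / (k + 1)
    \<le> ((k + 1) / k) powr (2 * a) * ((1 + a) * \<Lambda>^2 - T)"
proof -
  \<comment> \<open>\<open>y\<close> is the weight of the new value in the new mean and
    \<open>s\<close> its deviation from the old mean; the new deficit becomes
    \<open>(1 - y) * F + y * N\<close>.\<close>
  define y s F where "y = 1 / (k + 1)" and "s = m - \<Lambda>" and "F = (1 + a) * \<Lambda>^2 - T"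
  define R where "R = 1 + a * y + 2/3 * a * (1 + a) * y^2"
  define D where "D = s^2 - 2 * a * \<Lambda> * s + (a + 2 * a^2) * \<Lambda>^2"
  define N where "N = a * \<Lambda>^2 + 2 * a * \<Lambda> * s + ((1 + a) * y - 1) * s^2"
  have y: "0 \<le> y" "y \<le> 1/2" "y < 1" using k by (auto simp: y_def field_simps)
  have R0: "R \<ge> 0" using a y by (simp add: R_def)
  \<comment> \<open>\<open>D\<close> is the quadratic in \<open>yang\<close> with \<open>T\<close>
    replaced by \<open>(1 + a) * \<Lambda>^2\<close>, so \<open>yang\<close> bounds it by a multiple
    of \<open>F\<close>. Being a sum of squares, \<open>D\<close> also forces \<open>F\<close> to be
    nonnegative.\<close>
  have "D = m^2 - 2 * (1 + a) * m * \<Lambda> + (1 + 2 * a) * ((1 + a) * \<Lambda>^2)"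
    by (simp add: D_def s_def field_simps power2_eq_square)
  then have DF: "D \<le> (1 + 2 * a) * F" using yang by (simp add: F_def algebra_simps)
  have "D = (s - a * \<Lambda>)^2 + (a + a^2) * \<Lambda>^2"
    by (simp add: D_def field_simps power2_eq_square)
  then have "D \<ge> 0" using a by simp
  then have F0: "F \<ge> 0" using DF a
    by (smt (verit) mult_pos_neg)
  have "N \<le> R * D" unfolding N_def R_def D_def by (rule recursion_quadratic[OF a y(1,2)])
  also have "\<dots> \<le> R * ((1 + 2 * a) * F)" using DF R0 by (rule mult_left_mono)
  finally have NR: "N \<le> R * ((1 + 2 * a) * F)" .
  have m: "m = s + \<Lambda>" and T: "T = (1 + a) * \<Lambda>^2 - F" and ky: "k * y = 1 - y"
    using k by (auto simp: s_def F_def y_def field_simps)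
  have "(k * \<Lambda> + m) / (k + 1) = (k * y) * \<Lambda> + m * y"
    by (simp add: y_def add_divide_distrib)
  moreover have "(k * T + m^2) / (k + 1) = (k * y) * T + m^2 * y"
    by (simp add: y_def add_divide_distrib)
  ultimately have "(1 + a) * ((k * \<Lambda> + m) / (k + 1))^2 - (k * T + m^2) / (k + 1)
      = (1 + a) * ((1 - y) * \<Lambda> + m * y)^2 - ((1 - y) * T + m^2 * y)"
    by (simp add: ky)
  also have "\<dots> = (1 - y) * F + y * N"
    unfolding m T N_def by (simp add: field_simps power2_eq_square)
  also have "\<dots> \<le> (1 - y) * F + y * (R * ((1 + 2 * a) * F))"
    using NR y(1) by (simp add: mult_left_mono)
  also have "\<dots> = (1 + (2*a) * y + (2*a) * (2*a + 1) / 2 * y^2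
      + (2*a) * (2*a + 1) * (2*a + 2) / 6 * y^3) * F"
    unfolding R_def by (simp add: field_simps power2_eq_square power3_eq_cube)
  also have "\<dots> \<le> (1 - y) powr (- (2 * a)) * F"
    using a y F0 by (intro mult_right_mono inverse_powr_ge_taylor3) auto
  also have "(1 - y) powr (- (2 * a)) = ((k + 1) / k) powr (2 * a)"
  proof -
    have "1 - y = inverse ((k + 1) / k)" using k by (simp add: y_def field_simps)
    then show ?thesis using k by (simp add: powr_minus powr_powr inverse_powr[symmetric] del: inverse_divide)
  qed
  finally show ?thesis by (simp add: F_def)
qed

text \<open>The ratios \<open>(j + 1) / j\<close> telescope, which bounds \<open>F k\<close> by
  \<open>F 1\<close>; Yang's inequality at \<open>k\<close> itself then converts this into a bound
  on \<open>\<mu> k\<close>.\<close>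

theorem cheng_yang_recursion:
  fixes \<mu> :: "nat \<Rightarrow> real" and a :: real
  assumes a: "0 < a" and k: "1 \<le> k" and \<mu>0: "0 \<le> \<mu> 0"
    and yang: "\<And>j. 1 \<le> j \<Longrightarrow> j \<le> k \<Longrightarrow>
      (\<Sum>i<j. (\<mu> j - \<mu> i)^2) \<le> 2 * a * (\<Sum>i<j. \<mu> i * (\<mu> j - \<mu> i))"
  shows "\<mu> k \<le> (1 + 2 * a) * real k powr a * \<mu> 0"
proof -
  define \<Lambda> T where "\<Lambda> j = (\<Sum>i<j. \<mu> i) / real j" and "T j = (\<Sum>i<j. (\<mu> i)^2) / real j" for j
  define F where "F j = (1 + a) * (\<Lambda> j)^2 - T j" for j
  have yang': "(\<mu> j)^2 - 2 * (1 + a) * \<mu> j * \<Lambda> j + (1 + 2 * a) * T j \<le> 0"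
    if j: "1 \<le> j" "j \<le> k" for j
  proof -
    have "(\<Sum>i<j. (\<mu> j - \<mu> i)^2) - 2 * a * (\<Sum>i<j. \<mu> i * (\<mu> j - \<mu> i))
        = real j * (\<mu> j)^2 - 2 * (1 + a) * \<mu> j * (\<Sum>i<j. \<mu> i) + (1 + 2 * a) * (\<Sum>i<j. (\<mu> i)^2)"
      by (simp add: power2_diff sum.distrib sum_subtractf sum_distrib_left algebra_simps power2_eq_square)
    also have "\<dots> = real j * ((\<mu> j)^2 - 2 * (1 + a) * \<mu> j * \<Lambda> j + (1 + 2 * a) * T j)"
      using j by (simp add: \<Lambda>_def T_def field_simps)
    finally have "real j * ((\<mu> j)^2 - 2 * (1 + a) * \<mu> j * \<Lambda> j + (1 + 2 * a) * T j) \<le> 0"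
      using yang[OF j] by linarith
    then show ?thesis using j by (simp add: mult_le_0_iff)
  qed
  have step: "F (Suc j) \<le> ((real j + 1) / real j) powr (2 * a) * F j" if j: "1 \<le> j" "j < k" for j
  proof -
    have "\<Lambda> (Suc j) = (real j * \<Lambda> j + \<mu> j) / (real j + 1)"
      and "T (Suc j) = (real j * T j + (\<mu> j)^2) / (real j + 1)"
      using j by (simp_all add: \<Lambda>_def T_def add.commute)
    then show ?thesis
      unfolding F_def using yang_deficit_step[of a "real j" "\<mu> j" "\<Lambda> j" "T j"] yang'[of j] a j by simp
  qed
  have bound: "F j \<le> real j powr (2 * a) * F 1" if "1 \<le> j" "j \<le> k" for j
    using that
  proof (induction j rule: nat_induct_at_least)
    case (Suc j)
    have "F (Suc j) \<le> ((real j + 1) / real j) powr (2 * a) * F j" using step Suc by simp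
    also have "\<dots> \<le> ((real j + 1) / real j) powr (2 * a) * (real j powr (2 * a) * F 1)"
      using Suc by (intro mult_left_mono) auto
    also have "\<dots> = real (Suc j) powr (2 * a) * F 1"
      using Suc.hyps by (simp add: powr_divide add.commute)
    finally show ?case .
  qed simp
  define m where "m = \<mu> k"
  \<comment> \<open>The added square turns \<open>m^2 * a\<close> into \<open>1 + 2 * a\<close>
    times the quadratic of \<open>yang'\<close> with \<open>T k\<close> replaced by
    \<open>(1 + a) * (\<Lambda> k)^2\<close>, so only \<open>F k\<close> remains on the
    right.\<close>
  have "m^2 * a \<le> m^2 * a + (1 + a) * (m - (1 + 2 * a) * \<Lambda> k)^2"
    using a by simp
  also have "\<dots> = (1 + 2 * a) * (m^2 - 2 * (1 + a) * m * \<Lambda> k + (1 + 2 * a) * ((1 + a) * (\<Lambda> k)^2))"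
    by (simp add: field_simps power2_eq_square)
  also have "\<dots> \<le> (1 + 2 * a) * ((1 + 2 * a) * F k)"
    using yang'[OF k order_refl] a unfolding m_def F_def
    by (intro mult_left_mono) (auto simp: algebra_simps)
  also have "\<dots> = (1 + 2 * a)^2 * F k"
    by (simp add: power2_eq_square)
  also have "\<dots> \<le> (1 + 2 * a)^2 * (real k powr (2 * a) * F 1)"
    using bound[OF k order_refl] by (intro mult_left_mono) auto
  also have "F 1 = a * (\<mu> 0)^2"
    by (simp add: F_def \<Lambda>_def T_def field_simps)
  also have "real k powr (2 * a) = (real k powr a)^2"
    by (simp add: power2_eq_square powr_add[symmetric])
  finally have "a * m^2 \<le> a * ((1 + 2 * a) * real k powr a * \<mu> 0)^2"
    by (simp add: power_mult_distrib mult_ac)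
  then have "m^2 \<le> ((1 + 2 * a) * real k powr a * \<mu> 0)^2" using a by simp
  then show ?thesis unfolding m_def
    by (rule power2_le_imp_le) (use a \<mu>0 in auto)
qed

section \<open>The eigenvalue bound\<close>

text \<open>Every overlap is at most 1, since a positive multiple of 1 minus it dominates a squared
  norm; the mean of the overlaps over the directions is 1 minus the eigenvalue.\<close>

lemma dirichlet_eigenvalue_nonneg:
  fixes \<Omega> :: "(int ^ 'n) set"
  assumes \<Omega>: "finite \<Omega>" and i: "i < card \<Omega>"
  shows "0 \<le> dirichlet_eigenvalue \<Omega> (Suc i)"
proof -
  obtain u where u: "u \<in> dirichlet_eigenspace \<Omega> (dirichlet_eigenvalue \<Omega> (Suc i))"
    and u1: "fn_inner \<Omega> u u = 1"
    using exists_orthonormal_dirichlet_eigenfunctions[OF \<Omega>] i by blast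
  have uS: "u \<in> functions_on \<Omega>" using u by (simp add: dirichlet_eigenspace_def)
  have "directional_overlap \<Omega> \<alpha> u \<le> 1" for \<alpha>
  proof -
    have "0 \<le> 2 / (real CARD('n))^2 * (1 - directional_overlap \<Omega> \<alpha> u)"
      using fn_inner_nonneg fn_inner_central_difference_le[OF \<Omega> uS u1] order_trans by blast
    then show ?thesis by (simp add: zero_le_mult_iff zero_le_divide_iff)
  qed
  then have "(\<Sum>\<alpha>\<in>UNIV. directional_overlap \<Omega> \<alpha> u) \<le> (\<Sum>\<alpha>\<in>(UNIV::'n set). 1)"
    by (intro sum_mono)
  then show ?thesis
    unfolding sum_directional_overlap[OF \<Omega> u u1] by simp
qed

lemma dirichlet_eigenvalue_bound:
  fixes \<Omega> :: "(int ^ 'n) set"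
  assumes \<Omega>: "finite \<Omega>" and k: "1 \<le> k" "k < card \<Omega>"
    and \<delta>: "0 < \<delta>" "dirichlet_eigenvalue \<Omega> k \<le> 1 - \<delta>"
  shows "dirichlet_eigenvalue \<Omega> (k + 1) \<le> (1 + 4 / (real CARD('n) * \<delta>))
    * real k powr (2 / (real CARD('n) * \<delta>)) * dirichlet_eigenvalue \<Omega> 1"
proof -
  define a where "a = 2 / (real CARD('n) * \<delta>)"
  define l where "l i = dirichlet_eigenvalue \<Omega> (Suc i)" for i
  have a: "0 < a" using \<delta> by (simp add: a_def)
  have "0 \<le> l 0" unfolding l_def using k by (intro dirichlet_eigenvalue_nonneg[OF \<Omega>]) simp
  have "l k \<le> (1 + 2 * a) * real k powr a * l 0"
  proof (rule cheng_yang_recursion[where \<mu> = l, OF a k(1) \<open>0 \<le> l 0\<close>])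
    fix j assume j: "1 \<le> j" "j \<le> k"
    \<comment> \<open>The factors \<open>1 - l i\<close> involve only the first \<open>k\<close>
      eigenvalues, so \<open>\<delta>\<close> bounds them all even if \<open>l k\<close>, which is
      \<open>\<lambda>\<^sub>k\<^sub>+\<^sub>1\<close>, exceeds \<open>1 - \<delta>\<close>.\<close>
    have gap: "\<delta> \<le> 1 - l i" if "i < j" for i
    proof -
      have "l i \<le> dirichlet_eigenvalue \<Omega> (Suc (k - 1))"
        unfolding l_def using that j k by (intro dirichlet_eigenvalue_mono[OF \<Omega>]) auto
      then show ?thesis using \<delta>(2) k(1) by simp
    qed
    have "\<delta> * (\<Sum>i<j. (l j - l i)^2) \<le> (\<Sum>i<j. (l j - l i)^2 * (1 - l i))"
      unfolding sum_distrib_left using gap by (intro sum_mono) (simp add: mult.commute mult_right_mono)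
    also have "\<dots> \<le> 4 / real CARD('n) * (\<Sum>i<j. (l j - l i) * l i)"
      unfolding l_def using j k by (intro dirichlet_yang_inequality[OF \<Omega>]) simp
    finally show "(\<Sum>i<j. (l j - l i)^2) \<le> 2 * a * (\<Sum>i<j. l i * (l j - l i))"
      using \<delta> by (simp add: a_def field_simps)
  qed
  then show ?thesis by (simp add: l_def a_def)
qed

theorem corollary1p6:
  fixes \<Omega> :: "(int ^ 'n) set" and k :: nat
  assumes "finite \<Omega>" and "1 \<le> k" and "k \<le> card \<Omega> - 1"
  shows "(dirichlet_eigenvalue \<Omega> k < 1 \<longrightarrow>
      dirichlet_eigenvalue \<Omega> (k + 1)
        \<le> (1 + 4 / (real CARD('n) * (1 - dirichlet_eigenvalue \<Omega> k)))
          * real k powr (2 / (real CARD('n) * (1 - dirichlet_eigenvalue \<Omega> k)))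
          * dirichlet_eigenvalue \<Omega> 1) \<and>
    (\<forall>\<delta>::real. \<delta> > 0 \<and> dirichlet_eigenvalue \<Omega> k \<le> 1 - \<delta> \<longrightarrow>
      dirichlet_eigenvalue \<Omega> (k + 1)
        \<le> (1 + 4 / (real CARD('n) * \<delta>))
          * real k powr (2 / (real CARD('n) * \<delta>))
          * dirichlet_eigenvalue \<Omega> 1)"
proof -
  \<comment> \<open>The subtraction is truncated, but \<open>1 \<le> k\<close> rules out an empty
    \<open>\<Omega>\<close>.\<close>
  have k: "k < card \<Omega>" using assms(2,3) by linarith
  \<comment> \<open>The first claim is the case
    \<open>\<delta> = 1 - dirichlet_eigenvalue \<Omega> k\<close> of the second.\<close>
  show ?thesis
    using dirichlet_eigenvalue_bound[OF assms(1,2) k, of "1 - dirichlet_eigenvalue \<Omega> k"]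
      dirichlet_eigenvalue_bound[OF assms(1,2) k] by simp
qed

end
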